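(* Let $G$ be a connected, infinite, locally finite graph such that for every vertex $x\in V(G)$ the ball $G_2(x)$ of radius $2$ is $2$-connected, and such that $d_G(u)+d_G(v)\ge |M_2(w)|-1$ for each path $uwv$ in $G$ (with $u,w,v$ distinct vertices) with $uv\notin E(G)$. Then $G$ has a Hamiltonian curve.
   Context: Graphs have no loops or multiple edges. A graph is locally finite if every vertex has finite degree; $d_G(u)$ is the degree of $u$ in $G$. For a vertex $u$ of a graph $G$ and an integer $r\ge 0$, $M_r(u)$ is the set of vertices at distance at most $r$ from $u$ in $G$, and the ball $G_r(u)$ of radius $r$ centered at $u$ is the subgraph of $G$ induced by $M_r(u)$. A graph is $k$-connected if the removal of fewer than $k$ vertices results in neither a disconnected graph nor the trivial graph consisting of a single vertex. A ray is a one-way infinite path. Two rays of $G$ are equivalent if for every finite $S\subset V(G)$ both have a tail in the same component of $G-S$; the equivalence classes are the ends of $G$. $|G|$ denotes the Freudenthal compactification of $G$: the topological space obtained from $G$, viewed as a 1-complex, by adding the ends of $G$ as additional points, with the standard topology (every ray converges to the end containing it). A closed curve in $|G|$ is the image of a continuous map from the unit circle $S^1$ to $|G|$. A Hamiltonian curve of $G$ is a closed curve in $|G|$ that meets every vertex of $G$ exactly once (i.e. each vertex is the image of exactly one point of $S^1$). *)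

theory Defs
  imports "HOL-Analysis.Analysis"
begin

section \<open>Graphs\<close>

record 'a ugraph =
  verts :: "'a set"
  edges :: "'a set set"

definition simple_graph :: "'a ugraph \<Rightarrow> bool" where
  "simple_graph G \<longleftrightarrow> (\<forall>e\<in>edges G. e \<subseteq> verts G \<and> card e = 2)"

definition neighbours :: "'a ugraph \<Rightarrow> 'a \<Rightarrow> 'a set" where
  "neighbours G u = {v. {u, v} \<in> edges G}"

definition graph_degree :: "'a ugraph \<Rightarrow> 'a \<Rightarrow> nat" where
  "graph_degree G u = card (neighbours G u)"

definition locally_finite :: "'a ugraph \<Rightarrow> bool" where
  "locally_finite G \<longleftrightarrow> (\<forall>u\<in>verts G. finite (neighbours G u))"

definition induced_subgraph :: "'a ugraph \<Rightarrow> 'a set \<Rightarrow> 'a ugraph" where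
  "induced_subgraph G M = \<lparr>verts = verts G \<inter> M, edges = {e \<in> edges G. e \<subseteq> M}\<rparr>"

definition delete_verts :: "'a ugraph \<Rightarrow> 'a set \<Rightarrow> 'a ugraph" where
  "delete_verts G S = induced_subgraph G (verts G - S)"

text \<open>A finite path is given by the list of its vertices; its length is its number of edges.\<close>

definition graph_path :: "'a ugraph \<Rightarrow> 'a list \<Rightarrow> bool" where
  "graph_path G p \<longleftrightarrow> p \<noteq> [] \<and> set p \<subseteq> verts G \<and> distinct p \<and>
     (\<forall>i. Suc i < length p \<longrightarrow> {p ! i, p ! Suc i} \<in> edges G)"

definition paths_between :: "'a ugraph \<Rightarrow> 'a \<Rightarrow> 'a \<Rightarrow> 'a list set" where
  "paths_between G u v = {p. graph_path G p \<and> hd p = u \<and> last p = v}"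

definition distance :: "'a ugraph \<Rightarrow> 'a \<Rightarrow> 'a \<Rightarrow> enat" where
  "distance G u v = (INF p\<in>paths_between G u v. enat (length p - 1))"

definition ball_verts :: "'a ugraph \<Rightarrow> nat \<Rightarrow> 'a \<Rightarrow> 'a set" where
  "ball_verts G r u = {v \<in> verts G. distance G u v \<le> enat r}"

definition graph_ball :: "'a ugraph \<Rightarrow> nat \<Rightarrow> 'a \<Rightarrow> 'a ugraph" where
  "graph_ball G r u = induced_subgraph G (ball_verts G r u)"

definition connected_graph :: "'a ugraph \<Rightarrow> bool" where
  "connected_graph G \<longleftrightarrow> verts G \<noteq> {} \<and>
     (\<forall>u\<in>verts G. \<forall>v\<in>verts G. paths_between G u v \<noteq> {})"

definition k_connected :: "nat \<Rightarrow> 'a ugraph \<Rightarrow> bool" where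
  "k_connected k G \<longleftrightarrow> (\<forall>S. S \<subseteq> verts G \<and> finite S \<and> card S < k \<longrightarrow>
     connected_graph (delete_verts G S) \<and> \<not> is_singleton (verts (delete_verts G S)))"

text \<open>Components are represented by their vertex sets.\<close>

definition graph_components :: "'a ugraph \<Rightarrow> 'a set set" where
  "graph_components G = {{v \<in> verts G. paths_between G u v \<noteq> {}} |u. u \<in> verts G}"

section \<open>Ends\<close>

text \<open>A ray is given by the sequence of its vertices, enumerated from its starting vertex.\<close>

definition rays :: "'a ugraph \<Rightarrow> (nat \<Rightarrow> 'a) set" where
  "rays G = {r. inj r \<and> range r \<subseteq> verts G \<and> (\<forall>i. {r i, r (Suc i)} \<in> edges G)}"

definition tail_in :: "(nat \<Rightarrow> 'a) \<Rightarrow> 'a set \<Rightarrow> bool" where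
  "tail_in r C \<longleftrightarrow> (\<exists>n. \<forall>i\<ge>n. r i \<in> C)"

definition ray_equiv :: "'a ugraph \<Rightarrow> ((nat \<Rightarrow> 'a) \<times> (nat \<Rightarrow> 'a)) set" where
  "ray_equiv G = {(r, r'). r \<in> rays G \<and> r' \<in> rays G \<and>
     (\<forall>S. finite S \<and> S \<subseteq> verts G \<longrightarrow>
        (\<exists>C\<in>graph_components (delete_verts G S). tail_in r C \<and> tail_in r' C))}"

definition ends :: "'a ugraph \<Rightarrow> (nat \<Rightarrow> 'a) set set" where
  "ends G = rays G // ray_equiv G"

definition end_lives_in :: "'a ugraph \<Rightarrow> 'a set \<Rightarrow> (nat \<Rightarrow> 'a) set \<Rightarrow> 'a set \<Rightarrow> bool" where
  "end_lives_in G S \<omega> C \<longleftrightarrow>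
     \<omega> \<in> ends G \<and> C \<in> graph_components (delete_verts G S) \<and> (\<forall>r\<in>\<omega>. tail_in r C)"

section \<open>The Freudenthal compactification\<close>

text \<open>Points of the 1-complex are given by barycentric coordinates with respect to the vertices.\<close>

definition vertex_coords :: "'a \<Rightarrow> 'a \<Rightarrow> real" where
  "vertex_coords v = indicator {v}"

definition edge_coords :: "'a \<Rightarrow> 'a \<Rightarrow> real \<Rightarrow> 'a \<Rightarrow> real" where
  "edge_coords u v t = (\<lambda>w. (1 - t) * vertex_coords u w + t * vertex_coords v w)"

datatype 'a fpoint = Pt "'a \<Rightarrow> real" | End "(nat \<Rightarrow> 'a) set"

abbreviation Vertex :: "'a \<Rightarrow> 'a fpoint" where
  "Vertex v \<equiv> Pt (vertex_coords v)"

abbreviation EdgePt :: "'a \<Rightarrow> 'a \<Rightarrow> real \<Rightarrow> 'a fpoint" where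
  "EdgePt u v t \<equiv> Pt (edge_coords u v t)"

definition one_complex :: "'a ugraph \<Rightarrow> 'a fpoint set" where
  "one_complex G = Vertex ` verts G \<union> {EdgePt u v t |u v t. {u, v} \<in> edges G \<and> t \<in> {0..1}}"

text \<open>The weak (CW) topology of the 1-complex: every edge is a copy of the unit interval.\<close>

definition open_in_complex :: "'a ugraph \<Rightarrow> 'a fpoint set \<Rightarrow> bool" where
  "open_in_complex G U \<longleftrightarrow> U \<subseteq> one_complex G \<and>
     (\<forall>u v. {u, v} \<in> edges G \<longrightarrow>
        openin (top_of_set {0..1}) {t \<in> {0..1}. EdgePt u v t \<in> U})"

text \<open>
  The basic neighbourhood, determined by a finite vertex set \<open>S\<close> and \<open>\<epsilon> > 0\<close>, of the ends
  living in the component \<open>C\<close> of \<open>G - S\<close>: it consists of \<open>C\<close> itself, of all the ends living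
  in \<open>C\<close>, and of the inner points at distance less than \<open>\<epsilon>\<close> from \<open>C\<close> on the edges
  between \<open>C\<close> and \<open>S\<close>.
\<close>

definition end_nbhd :: "'a ugraph \<Rightarrow> 'a set \<Rightarrow> 'a set \<Rightarrow> real \<Rightarrow> 'a fpoint set" where
  "end_nbhd G S C \<epsilon> =
     one_complex (induced_subgraph G C)
     \<union> {End \<omega> |\<omega>. end_lives_in G S \<omega> C}
     \<union> {EdgePt c s t |c s t. c \<in> C \<and> s \<in> S \<and> {c, s} \<in> edges G \<and> 0 < t \<and> t < 1 \<and> t < \<epsilon>}"

definition freudenthal :: "'a ugraph \<Rightarrow> 'a fpoint topology" where
  "freudenthal G = topology_generated_by
     ({U. open_in_complex G U} \<union>
      {end_nbhd G S C \<epsilon> |S C \<epsilon>. finite S \<and> S \<subseteq> verts G \<and> 0 < \<epsilon> \<and>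
         (\<exists>\<omega>. end_lives_in G S \<omega> C)})"

section \<open>Hamiltonian curves\<close>

definition hamiltonian_curve :: "'a ugraph \<Rightarrow> 'a fpoint set \<Rightarrow> bool" where
  "hamiltonian_curve G K \<longleftrightarrow>
     (\<exists>f. continuous_map (top_of_set (sphere (0::complex) 1)) (freudenthal G) f \<and>
          K = f ` sphere 0 1 \<and>
          (\<forall>v\<in>verts G. \<exists>!z. z \<in> sphere 0 1 \<and> f z = Vertex v))"

end

theory Submission
  imports Defs "HOL-Complex_Analysis.Great_Picard"
begin

text \<open>
  First, every finite vertex set lies on a cycle. Otherwise some cycle \<open>C\<close> and vertex \<open>x\<close> adjacent
  to \<open>C\<close> admit no cycle through \<open>C\<close> and \<open>x\<close>; choose \<open>C\<close> with as many neighbours of \<open>x\<close> as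
  possible. With \<open>W\<close> the neighbours of \<open>x\<close> on \<open>C\<close> and \<open>W\<^sup>+\<close> their successors, \<open>W\<^sup>+\<close> together with
  \<open>x\<close> is independent, and double counting the edges between \<open>W\<close> and \<open>W\<^sup>+\<close> turns the degree condition
  into equality: for \<open>w \<in> W\<close>, every vertex at distance at most 2 from \<open>w\<close> is \<open>x\<close>, a neighbour of
  \<open>x\<close> or of \<open>w\<^sup>+\<close>, or lies in \<open>W\<^sup>+\<close>. The 2-connectedness of the ball around \<open>w\<close> excludes that
  \<open>w\<^sup>+\<close> is far from the rest of \<open>W\<close>, which forces \<open>C\<close> to alternate between \<open>W\<close> and \<open>W\<^sup>+\<close>; but
  then \<open>C\<close> and \<open>x\<close> have no further neighbours, contradicting that \<open>G\<close> is infinite and connected.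

  Second (Kuendgen, Li and Thomassen), a sequence of cycles through more and more vertices, cut open
  at a fixed vertex, has a subsequence along which the induced linear orders converge pointwise. In
  the limit order every vertex has an adjacent successor, and an interval that avoids a finite set
  \<open>S\<close> lies in one component of \<open>G - S\<close>. Hence every Dedekind gap of the order determines an
  end, and traversing the edges between consecutive vertices in the limit order, with the gaps
  mapped to their ends, gives a continuous closed curve.
\<close>


section \<open>Cycles as lists\<close>

text \<open>\<open>nxt p v\<close> is the successor of \<open>v\<close> on the cyclic list \<open>p\<close>; the predecessor is \<open>nxt (rev p) v\<close>.\<close>

definition nxt :: "'a list \<Rightarrow> 'a \<Rightarrow> 'a" where
  "nxt p v = p ! (Suc (THE i. i < length p \<and> p ! i = v) mod length p)"

lemma nxt_nth:
  assumes "distinct p" "i < length p"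
  shows "nxt p (p ! i) = p ! (Suc i mod length p)"
proof -
  have "(THE j. j < length p \<and> p ! j = p ! i) = i"
    using assms by (auto simp: nth_eq_iff_index_eq)
  then show ?thesis by (simp add: nxt_def)
qed

lemma nxt_append:
  assumes "distinct (xs @ v # ys)"
  shows "nxt (xs @ v # ys) v = hd (ys @ xs @ [v])"
proof -
  have "nxt (xs @ v # ys) ((xs @ v # ys) ! length xs)
      = (xs @ v # ys) ! (Suc (length xs) mod length (xs @ v # ys))"
    using assms by (intro nxt_nth) auto
  also have "\<dots> = hd (ys @ xs @ [v])"
  proof (cases ys)
    case Nil
    then show ?thesis by (cases xs) auto
  next
    case (Cons y ys')
    then show ?thesis by (auto simp: nth_append)
  qed
  finally show ?thesis by simp
qed

lemma nxt_Cons: "distinct (v # ys) \<Longrightarrow> nxt (v # ys) v = hd (ys @ [v])"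
  using nxt_append[of "[]" v ys] by simp

lemma nxt_swap_append:
  assumes "distinct (xs @ ys)" "v \<in> set (xs @ ys)"
  shows "nxt (ys @ xs) v = nxt (xs @ ys) v"
proof -
  have *: "nxt (ys @ xs) v = nxt (xs @ ys) v" if "v \<in> set xs" "distinct (xs @ ys)" for xs ys
  proof -
    obtain as bs where xs: "xs = as @ v # bs" using \<open>v \<in> set xs\<close> by (meson split_list)
    have "nxt ((ys @ as) @ v # bs) v = hd (bs @ (ys @ as) @ [v])"
      using that(2) xs by (intro nxt_append) auto
    moreover have "nxt (as @ v # (bs @ ys)) v = hd ((bs @ ys) @ as @ [v])"
      using that(2) xs by (intro nxt_append) auto
    ultimately show ?thesis by (simp add: xs)
  qed
  show ?thesis
  proof (cases "v \<in> set xs")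
    case True then show ?thesis using * assms by blast
  next
    case False
    then have "v \<in> set ys" "distinct (ys @ xs)" using assms by auto
    then show ?thesis using *[of ys xs] by simp
  qed
qed

lemma nxt_in_set: "distinct p \<Longrightarrow> v \<in> set p \<Longrightarrow> nxt p v \<in> set p"
  by (metis in_set_conv_nth length_pos_if_in_set mod_less_divisor nth_mem nxt_nth)

lemma nxt_rev_nxt:
  assumes "distinct p" "v \<in> set p"
  shows "nxt (rev p) (nxt p v) = v"
proof -
  obtain xs ys where p: "p = xs @ v # ys" using assms(2) by (meson split_list)
  have "distinct (v # ys @ xs)" using assms p by auto
  have n: "nxt p v = hd (ys @ xs @ [v])" using nxt_append[of xs v ys] assms p by simp
  have d: "distinct (rev (ys @ xs) @ [v])" using assms p by auto
  have "distinct ((rev ys @ [v]) @ rev xs)" "nxt p v \<in> set ((rev ys @ [v]) @ rev xs)"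
    using assms nxt_in_set[OF assms] by (auto simp: p)
  then have "nxt (rev p) (nxt p v) = nxt (rev xs @ rev ys @ [v]) (nxt p v)"
    using nxt_swap_append[of "rev ys @ [v]" "rev xs" "nxt p v"] by (simp add: p)
  also have "\<dots> = v"
  proof (cases "ys @ xs")
    case Nil then show ?thesis using n by (simp add: nxt_def)
  next
    case (Cons z zs)
    have z: "nxt p v = z" using n Cons by (metis append_Cons append_assoc list.sel(1))
    have e: "rev xs @ rev ys @ [v] = rev zs @ z # [v]"
      using arg_cong[OF Cons, of rev] by simp
    show ?thesis unfolding z e
      using d Cons by (subst nxt_append) auto
  qed
  finally show ?thesis .
qed

lemma nxt_nxt_rev:
  assumes "distinct p" "v \<in> set p"
  shows "nxt p (nxt (rev p) v) = v"
  using nxt_rev_nxt[of "rev p" v] assms by simp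

lemma nxt_rev_eq: "distinct p \<Longrightarrow> a \<in> set p \<Longrightarrow> nxt p a = b \<Longrightarrow> nxt (rev p) b = a"
  using nxt_rev_nxt by metis

text \<open>Once the list is rotated so that \<open>w\<close> comes first, membership in
  \<open>B\<close> propagates by induction on the index. It serves to show that attachments and
  their successors exhaust a cycle.\<close>

lemma set_subset_nxt_closed:
  assumes "distinct p" "w \<in> set p" "w \<in> B" "\<And>v. v \<in> set p \<Longrightarrow> v \<in> B \<Longrightarrow> nxt p v \<in> B"
  shows "set p \<subseteq> B"
proof -
  obtain xs ys where p: "p = xs @ w # ys" using assms(2) by (meson split_list)
  define q where "q = w # ys @ xs"
  have q: "distinct q" "set q = set p" using assms(1) by (auto simp: p q_def)
  have n: "nxt q v = nxt p v" if "v \<in> set p" for v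
    using nxt_swap_append[of xs "w # ys" v] assms(1) that by (simp add: p q_def)
  have "q ! i \<in> B" if "i < length q" for i
    using that
  proof (induction i)
    case 0 then show ?case using assms(3) by (simp add: q_def)
  next
    case (Suc i)
    then have "q ! Suc i = nxt q (q ! i)" using nxt_nth[OF q(1), of i] by simp
    also have "\<dots> \<in> B" using Suc n assms(4) q(2) by (metis Suc_lessD nth_mem)
    finally show ?case .
  qed
  then show ?thesis using q(2) by (metis in_set_conv_nth subsetI)
qed

lemma inj_on_nxt: "distinct p \<Longrightarrow> inj_on (nxt p) (set p)"
  by (metis inj_onI nxt_rev_nxt)

text \<open>Applied to a path in a punctured ball, this yields the edge on which the path leaves the
  closed neighbourhood of a vertex.\<close>

lemma rtranclp_crossing:
  assumes "R\<^sup>*\<^sup>* x y" "P x" "\<not> P y"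
  shows "\<exists>a b. R\<^sup>*\<^sup>* x a \<and> R a b \<and> P a \<and> \<not> P b"
  using assms by (induction rule: rtranclp_induct) auto

lemma successively_imp_rtranclp:
  assumes "successively R p" "p \<noteq> []"
  shows "R\<^sup>*\<^sup>* (hd p) (last p)"
  using assms
proof (induction p rule: induct_list012)
  case (3 x y zs)
  then have "R x y" "R\<^sup>*\<^sup>* y (last (y # zs))" by auto
  then show ?case by (simp add: converse_rtranclp_into_rtranclp)
qed auto

lemma rtranclp_imp_distinct_path:
  assumes "R\<^sup>*\<^sup>* x y"
  shows "\<exists>p. p \<noteq> [] \<and> distinct p \<and> successively R p \<and> hd p = x \<and> last p = y"
  using assms
proof (induction rule: rtranclp_induct)
  case base
  show ?case by (intro exI[of _ "[x]"]) auto
next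
  case (step y z)
  then obtain p where p: "p \<noteq> []" "distinct p" "successively R p" "hd p = x" "last p = y" by blast
  show ?case
  proof (cases "z \<in> set p")
    case True
    \<comment> \<open>If the walk returns to \<open>z\<close>, it is cut off at the earlier
      occurrence of \<open>z\<close>.\<close>
    then obtain as bs where as: "p = as @ z # bs" by (meson split_list)
    then show ?thesis using p
      by (intro exI[of _ "as @ [z]"]) (auto simp: successively_append_iff hd_append)
  next
    case False
    then show ?thesis using p step
      by (intro exI[of _ "p @ [z]"]) (auto simp: successively_append_iff)
  qed
qed

section \<open>Reachability and balls of radius 2\<close>

locale simple_ugraph =
  fixes G :: "'a ugraph"
  assumes simple: "simple_graph G"
begin

abbreviation adj :: "'a \<Rightarrow> 'a \<Rightarrow> bool" where
  "adj u v \<equiv> {u, v} \<in> edges G"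

lemma adj_verts: "adj u v \<Longrightarrow> u \<in> verts G \<and> v \<in> verts G \<and> u \<noteq> v"
  using simple by (fastforce simp: simple_graph_def)

lemma adj_sym: "adj u v \<Longrightarrow> adj v u"
  by (simp add: insert_commute)

lemma singleton_not_edge [simp]: "{x} \<notin> edges G"
  using simple by (fastforce simp: simple_graph_def)

lemma in_neighbours [simp]: "v \<in> neighbours G u \<longleftrightarrow> adj u v"
  by (simp add: neighbours_def)

text \<open>Trades paths as lists for a transitive closure, since every walk contains a path. The
  condition on \<open>u\<close> has to be stated because the closure is reflexive even outside the
  graph.\<close>

lemma paths_between_delete_verts:
  "paths_between (delete_verts G S) u v \<noteq> {} \<longleftrightarrow>
     u \<in> verts G - S \<and> (\<lambda>a b. adj a b \<and> a \<notin> S \<and> b \<notin> S)\<^sup>*\<^sup>* u v" (is "?L \<longleftrightarrow> ?R")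
proof
  assume ?L
  then obtain p where p: "graph_path (delete_verts G S) p" "hd p = u" "last p = v"
    by (auto simp: paths_between_def)
  then have "p \<noteq> []" "set p \<subseteq> verts G - S"
    by (auto simp: graph_path_def delete_verts_def induced_subgraph_def)
  moreover have "successively (\<lambda>a b. adj a b \<and> a \<notin> S \<and> b \<notin> S) p"
    using p by (auto simp: graph_path_def delete_verts_def induced_subgraph_def successively_conv_nth)
  ultimately show ?R using successively_imp_rtranclp p hd_in_set by blast
next
  assume R: ?R
  then obtain p where p: "p \<noteq> []" "distinct p" "successively (\<lambda>a b. adj a b \<and> a \<notin> S \<and> b \<notin> S) p"
    "hd p = u" "last p = v" using rtranclp_imp_distinct_path[OF R[THEN conjunct2]] by blast
  have "p ! i \<in> verts G - S" if "i < length p" for i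
  proof (cases i)
    case 0 then show ?thesis using R p hd_conv_nth by fastforce
  next
    case (Suc j)
    then show ?thesis using p(3) that adj_verts by (auto simp: successively_conv_nth)
  qed
  then have "set p \<subseteq> verts G - S" by (metis in_set_conv_nth subsetI)
  moreover have "{p ! i, p ! Suc i} \<in> edges (delete_verts G S)" if "Suc i < length p" for i
    using p(3) that adj_verts
    by (auto simp: successively_conv_nth delete_verts_def induced_subgraph_def)
  ultimately have "graph_path (delete_verts G S) p"
    using p by (auto simp: graph_path_def delete_verts_def induced_subgraph_def)
  then show ?L using p by (auto simp: paths_between_def)
qed

lemma paths_between_iff:
  "paths_between G u v \<noteq> {} \<longleftrightarrow> u \<in> verts G \<and> adj\<^sup>*\<^sup>* u v"
proof -
  have "{e \<in> edges G. e \<subseteq> verts G} = edges G" using simple by (auto simp: simple_graph_def)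
  then have "delete_verts G {} = G"
    by (simp add: delete_verts_def induced_subgraph_def)
  then show ?thesis using paths_between_delete_verts[of "{}"] by simp
qed

lemma distance_le_iff:
  "distance G u v \<le> enat n \<longleftrightarrow> (\<exists>p\<in>paths_between G u v. length p - 1 \<le> n)" (is "?L \<longleftrightarrow> ?R")
proof
  assume L: ?L
  let ?A = "(\<lambda>p. enat (length p - 1)) ` paths_between G u v"
  have ne: "?A \<noteq> {}"
    using L by (auto simp: distance_def top_enat_def)
  obtain k where "k \<in> ?A" using ne by blast
  then have "(LEAST k. k \<in> ?A) \<in> ?A" by (rule LeastI)
  then have "Inf ?A \<in> ?A" using ne by (simp add: Inf_enat_def)
  then obtain p where "p \<in> paths_between G u v" "Inf ?A = enat (length p - 1)" by blast
  then show ?R using L by (auto simp: distance_def)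
next
  assume ?R
  then show ?L unfolding distance_def by (meson INF_lower2 enat_ord_simps(1))
qed

lemma ball_verts_2_iff:
  assumes "w \<in> verts G"
  shows "v \<in> ball_verts G 2 w \<longleftrightarrow> v = w \<or> adj w v \<or> (\<exists>c. adj w c \<and> adj c v)" (is "?L \<longleftrightarrow> ?R")
proof
  assume ?L
  then obtain p where p: "p \<in> paths_between G w v" "length p - 1 \<le> 2"
    by (auto simp: ball_verts_def distance_le_iff)
  have s: "successively adj p"
    using p by (auto simp: paths_between_def graph_path_def successively_conv_nth)
  have ne: "p \<noteq> []" "hd p = w" "last p = v" using p by (auto simp: paths_between_def graph_path_def)
  have "length p = 1 \<or> length p = 2 \<or> length p = 3" using p(2) ne(1)
    by (cases "length p") auto
  then show ?R
  proof (elim disjE)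
    assume "length p = 1" then obtain a where "p = [a]" by (auto simp: length_Suc_conv)
    then show ?thesis using ne by auto
  next
    assume "length p = 2" then obtain a b where "p = [a,b]" by (auto simp: length_Suc_conv numeral_2_eq_2)
    then show ?thesis using ne s by auto
  next
    assume "length p = 3" then obtain a b c where "p = [a,b,c]" by (auto simp: length_Suc_conv numeral_3_eq_3)
    then show ?thesis using ne s by auto
  qed
next
  assume R: ?R
  have *: "v \<in> ball_verts G 2 w" if "graph_path G p" "hd p = w" "last p = v" "length p \<le> 3" for p
  proof -
    have "v \<in> verts G" using that by (auto simp: graph_path_def)
    moreover have "p \<in> paths_between G w v" "length p - 1 \<le> 2"
      using that by (auto simp: paths_between_def)
    ultimately show ?thesis unfolding ball_verts_def distance_le_iff by blast
  qed
  consider "v = w" | "v \<noteq> w" "adj w v" | c where "v \<noteq> w" "adj w c" "adj c v" using R by blast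
  then show ?L
  proof cases
    case 1 then show ?thesis using assms by (intro *[of "[w]"]) (auto simp: graph_path_def)
  next
    case 2 then show ?thesis using assms adj_verts by (intro *[of "[w,v]"]) (auto simp: graph_path_def)
  next
    case 3
    have "{[w,c,v] ! i, [w,c,v] ! Suc i} \<in> edges G" if "Suc i < 3" for i
      using that 3 by (cases i) auto
    then have "graph_path G [w,c,v]"
      using 3 assms adj_verts[of w c] adj_verts[of c v] by (auto simp: graph_path_def)
    then show ?thesis by (intro *[of "[w,c,v]"]) auto
  qed
qed

section \<open>Cycles in a graph and two ways of rerouting them\<close>

definition is_cycle :: "'a list \<Rightarrow> bool" where
  "is_cycle p \<longleftrightarrow> distinct p \<and> 3 \<le> length p \<and> successively adj (p @ [hd p])"

lemma is_cycle_distinct: "is_cycle p \<Longrightarrow> distinct p"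
  by (simp add: is_cycle_def)

lemma is_cycle_swap:
  assumes "is_cycle (xs @ ys)" shows "is_cycle (ys @ xs)"
proof (cases "xs = [] \<or> ys = []")
  case True then show ?thesis using assms by auto
next
  case False
  then show ?thesis using assms
    by (auto simp: is_cycle_def successively_append_iff)
qed

lemma is_cycle_rev:
  assumes "is_cycle p" shows "is_cycle (rev p)"
proof -
  obtain v r where p: "p = v # r" using assms by (cases p) (auto simp: is_cycle_def)
  have "successively adj (v # r @ [v])" using assms by (simp add: is_cycle_def p)
  then have "successively (\<lambda>x y. adj y x) (rev (v # r @ [v]))" by (simp only: successively_rev)
  then have "successively adj (v # rev r @ [v])" by (simp add: insert_commute)
  then have "is_cycle (v # rev r)" using assms by (simp add: is_cycle_def p)
  then show ?thesis using is_cycle_swap[of "[v]" "rev r"] by (simp add: p)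
qed

lemma adj_nxt:
  assumes "is_cycle p" "v \<in> set p"
  shows "adj v (nxt p v)"
proof -
  obtain xs ys where p: "p = xs @ v # ys" using assms(2) by (meson split_list)
  have "is_cycle (v # ys @ xs)" using is_cycle_swap[of xs "v # ys"] assms(1) p by simp
  then have "successively adj (v # ys @ xs @ [v])" by (simp add: is_cycle_def)
  then have "adj v (hd (ys @ xs @ [v]))" by (cases "ys @ xs @ [v]") auto
  then show ?thesis using nxt_append[of xs v ys] is_cycle_distinct[OF assms(1)] p by simp
qed

lemma cycle_verts: "is_cycle p \<Longrightarrow> set p \<subseteq> verts G"
  using adj_nxt adj_verts by blast

lemma cycle_from:
  assumes "is_cycle p" "v \<in> set p"
  obtains r where "is_cycle (v # r)" "set (v # r) = set p"
    "\<And>a. a \<in> set p \<Longrightarrow> nxt (v # r) a = nxt p a"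
proof -
  obtain xs ys where p: "p = xs @ v # ys" using assms(2) by (meson split_list)
  have d: "distinct (xs @ v # ys)" using assms p by (simp add: is_cycle_def)
  show thesis
  proof (rule that[of "ys @ xs"])
    show "is_cycle (v # ys @ xs)" using is_cycle_swap[of xs "v # ys"] assms(1) p by simp
    show "nxt (v # ys @ xs) a = nxt p a" if "a \<in> set p" for a
      using nxt_swap_append[OF d, of a] that p by simp
  qed (auto simp: p)
qed

lemma cycle_from_from:
  assumes "is_cycle p" "v \<in> set p" "w \<in> set p" "v \<noteq> w"
  obtains r s where "is_cycle (v # r @ w # s)" "set (v # r @ w # s) = set p"
    "nxt p v = hd (r @ [w])" "nxt p w = hd (s @ [v])"
proof -
  obtain q where q: "is_cycle (v # q)" "set (v # q) = set p"
    "\<And>a. a \<in> set p \<Longrightarrow> nxt (v # q) a = nxt p a" using cycle_from[OF assms(1,2)] by blast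
  obtain r s where rs: "q = r @ w # s" using q assms by (metis set_ConsD split_list)
  have d: "distinct (v # r @ w # s)" using q rs by (auto simp: is_cycle_def)
  show thesis
  proof (rule that[of r s])
    show "nxt p v = hd (r @ [w])"
      using nxt_Cons[OF d] q(3)[OF assms(2)] rs by (cases r) auto
    show "nxt p w = hd (s @ [v])"
      using nxt_append[of "v # r" w s] d q(3)[OF assms(3)] rs by (cases s) auto
  qed (use q rs in auto)
qed

text \<open>The edge from \<open>w\<close> to its successor is replaced by the detour
  \<open>q\<close>.\<close>

lemma cycle_insert:
  assumes "is_cycle p" "w \<in> set p" "distinct q" "set q \<inter> set p = {}"
    and path: "successively adj (w # q @ [nxt p w])"
  shows "\<exists>p'. is_cycle p' \<and> set p' = set p \<union> set q"
proof -
  obtain r where r: "is_cycle (w # r)" "set (w # r) = set p"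
    "\<And>a. a \<in> set p \<Longrightarrow> nxt (w # r) a = nxt p a" using cycle_from[OF assms(1,2)] by blast
  have n: "nxt p w = hd (r @ [w])" using r assms nxt_Cons is_cycle_distinct by metis
  have "successively adj (r @ [w])" using r(1) by (cases r) (auto simp: is_cycle_def)
  moreover have "successively adj (w # q)" "adj (last (w # q)) (hd (r @ [w]))"
    using path n successively_append_iff[of adj "w # q" "[nxt p w]"] by auto
  ultimately have "successively adj ((w # q) @ (r @ [w]))"
    unfolding successively_append_iff by simp
  then have "is_cycle (w # q @ r)"
    using assms r by (auto simp: is_cycle_def)
  then show ?thesis using r by (intro exI[of _ "w # q @ r"]) auto
qed

text \<open>The edges from \<open>w\<close> and \<open>w'\<close> to their successors are dropped.
  The new cycle goes from \<open>w\<close> through \<open>q\<close> to \<open>w'\<close>, backwards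
  to \<open>nxt p w\<close>, across to \<open>nxt p w'\<close> and on to \<open>w\<close>.\<close>

lemma cycle_cross:
  assumes "is_cycle p" "w \<in> set p" "w' \<in> set p" "w \<noteq> w'" "distinct q" "set q \<inter> set p = {}"
    and path: "successively adj (w # q @ [w'])" and cross: "adj (nxt p w) (nxt p w')"
  shows "\<exists>p'. is_cycle p' \<and> set p' = set p \<union> set q"
proof -
  obtain r s where rs: "is_cycle (w # r @ w' # s)" "set (w # r @ w' # s) = set p"
    "nxt p w = hd (r @ [w'])" "nxt p w' = hd (s @ [w])"
    using cycle_from_from[OF assms(1-4)] by blast
  have s1: "successively adj (s @ [w])" "successively adj (r @ [w'])"
    using rs(1) by (auto simp: is_cycle_def successively_append_iff successively_Cons)
  have "successively (\<lambda>x y. adj y x) (rev (r @ [w']))" using s1(2) by (simp only: successively_rev)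
  then have s2: "successively adj (w' # rev r)" by (simp add: insert_commute)
  have s3: "successively adj ((w' # rev r) @ (s @ [w]))"
    unfolding successively_append_iff[of _ "w' # rev r"]
    using s1 s2 cross rs(3,4) by (cases r) auto
  have "successively adj (w # q)" "adj (last (w # q)) w'"
    using path successively_append_iff[of adj "w # q" "[w']"] by auto
  then have "successively adj ((w # q) @ ((w' # rev r) @ (s @ [w])))"
    unfolding successively_append_iff[of _ "w # q"] using s3 by simp
  then have "is_cycle (w # q @ w' # rev r @ s)"
    using assms rs by (auto simp: is_cycle_def)
  then show ?thesis using rs by (intro exI[of _ "w # q @ w' # rev r @ s"]) auto
qed

end

locale connected_locfin_graph = simple_ugraph +
  assumes connected: "connected_graph G"
    and infinite: "infinite (verts G)"
    and locfin: "locally_finite G"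
begin

lemma reachable: "u \<in> verts G \<Longrightarrow> v \<in> verts G \<Longrightarrow> adj\<^sup>*\<^sup>* u v"
  using connected paths_between_iff by (auto simp: connected_graph_def)

lemma finite_neighbours [simp]: "finite (neighbours G u)"
proof (cases "u \<in> verts G")
  case True then show ?thesis using locfin by (simp add: locally_finite_def)
next
  case False
  then have "neighbours G u = {}" using adj_verts by (auto simp: neighbours_def)
  then show ?thesis by simp
qed

end

lemma simple_ugraph_induced:
  assumes "simple_ugraph G" shows "simple_ugraph (induced_subgraph G M)"
  using assms by (auto simp: simple_ugraph_def simple_graph_def induced_subgraph_def)

section \<open>Extending cycles under the local degree condition\<close>

locale ore_graph = connected_locfin_graph +
  assumes ball_2_connected: "\<And>x. x \<in> verts G \<Longrightarrow> k_connected 2 (graph_ball G 2 x)"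
    and ore: "\<And>u w v. graph_path G [u, w, v] \<Longrightarrow> {u, v} \<notin> edges G \<Longrightarrow>
      int (graph_degree G u) + int (graph_degree G v) \<ge> int (card (ball_verts G 2 w)) - 1"
begin

abbreviation "N \<equiv> neighbours G"
abbreviation "M \<equiv> ball_verts G 2"

lemma finite_M:
  assumes "w \<in> verts G" shows "finite (M w)"
proof (rule finite_subset)
  show "M w \<subseteq> {w} \<union> N w \<union> \<Union> (N ` N w)" using ball_verts_2_iff[OF assms] by auto
qed auto

lemma M_self: "w \<in> verts G \<Longrightarrow> w \<in> M w" using ball_verts_2_iff by blast
lemma M_adj: "adj w v \<Longrightarrow> v \<in> M w" using ball_verts_2_iff adj_verts by blast
lemma M_adj2: "adj w c \<Longrightarrow> adj c v \<Longrightarrow> v \<in> M w" using ball_verts_2_iff adj_verts by blast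
text \<open>Inclusion-exclusion turns the degree sum into the sizes of the union and the
  intersection of the neighbourhoods. The union lies inside \<open>M w\<close>, so the degree
  condition bounds the part of \<open>M w\<close> that it misses.\<close>

lemma local_ore:
  assumes "adj x w" "adj w u" "x \<noteq> u" "\<not> adj x u"
  shows "card (M w - (N x \<union> N u)) \<le> card (N x \<inter> N u) + 1"
proof -
  have w: "w \<in> verts G" using assms adj_verts by blast
  have sub: "N x \<union> N u \<subseteq> M w"
    using assms M_adj2 adj_sym by (metis Un_iff in_neighbours subsetI)
  have path: "graph_path G [x, w, u]"
    using assms adj_verts[of x w] adj_verts[of w u]
    by (auto simp: graph_path_def less_Suc_eq nth_Cons' )
  have "card (N x) + card (N u) + 1 \<ge> card (M w)"
    using ore[OF path assms(4)] by (simp add: graph_degree_def)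
  moreover have "card (N x) + card (N u) = card (N x \<union> N u) + card (N x \<inter> N u)"
    by (rule card_Un_Int) auto
  moreover have "card (M w - (N x \<union> N u)) = card (M w) - card (N x \<union> N u)"
    using sub by (intro card_Diff_subset) auto
  ultimately show ?thesis by linarith
qed

text \<open>The set removed from the ball is \<open>M w \<inter> {c}\<close>, which has at most one
  element, so \<open>c\<close> may also lie outside the ball.\<close>

lemma punctured_ball_connected:
  assumes "w \<in> verts G" "c \<in> verts G" "x \<in> M w - {c}" "u \<in> M w - {c}"
  shows "(\<lambda>a b. adj a b \<and> a \<in> M w - {c} \<and> b \<in> M w - {c})\<^sup>*\<^sup>* x u"
proof -
  let ?B = "graph_ball G 2 w"
  have sB: "simple_ugraph ?B"
    using simple_ugraph_induced simple_ugraph_axioms by (simp add: graph_ball_def)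
  have v: "verts ?B = M w" by (auto simp: graph_ball_def induced_subgraph_def ball_verts_def)
  have e: "edges ?B = {e \<in> edges G. e \<subseteq> M w}"
    by (auto simp: graph_ball_def induced_subgraph_def)
  have "connected_graph (delete_verts ?B (M w \<inter> {c}))"
    using ball_2_connected[OF assms(1)] v by (auto simp: k_connected_def card.insert_remove Int_insert_right)
  moreover have "delete_verts ?B (M w \<inter> {c}) = delete_verts ?B {c}"
    using v by (simp add: delete_verts_def Diff_Int_distrib2 Diff_Int)
  ultimately have "paths_between (delete_verts ?B {c}) x u \<noteq> {}"
    using assms(3,4) v by (auto simp: connected_graph_def delete_verts_def induced_subgraph_def)
  then have "(\<lambda>a b. {a, b} \<in> edges ?B \<and> a \<notin> {c} \<and> b \<notin> {c})\<^sup>*\<^sup>* x u"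
    using simple_ugraph.paths_between_delete_verts[OF sB] by blast
  moreover have "(\<lambda>a b. {a, b} \<in> edges ?B \<and> a \<notin> {c} \<and> b \<notin> {c}) =
    (\<lambda>a b. adj a b \<and> a \<in> M w - {c} \<and> b \<in> M w - {c})" by (auto simp: e fun_eq_iff)
  ultimately show ?thesis by simp
qed

section \<open>Cycles that cannot absorb a neighbouring vertex\<close>

definition blocked :: "'a set \<Rightarrow> 'a \<Rightarrow> bool" where
  "blocked P x \<longleftrightarrow> (\<forall>q. is_cycle q \<longrightarrow> P \<subseteq> set q \<longrightarrow> x \<notin> set q)"

text \<open>A counterexample to the extension of cycles; the neighbours of \<open>x\<close> on
  \<open>p\<close> are its attachments. Apart from \<open>p\<close> being a cycle, only
  \<open>set p\<close> matters, so that \<open>p\<close> may be reversed or rearranged.\<close>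

definition stuck :: "'a list \<Rightarrow> 'a \<Rightarrow> bool" where
  "stuck p x \<longleftrightarrow> is_cycle p \<and> blocked (set p) x \<and> N x \<inter> set p \<noteq> {}"

lemma stuck_cycle: "stuck p x \<Longrightarrow> is_cycle p" by (simp add: stuck_def)

lemma stuck_distinct: "stuck p x \<Longrightarrow> distinct p" by (simp add: stuck_def is_cycle_distinct)

lemma stuck_notin: "stuck p x \<Longrightarrow> x \<notin> set p" by (auto simp: stuck_def blocked_def)

lemma stuck_same_set: "stuck p x \<Longrightarrow> is_cycle q \<Longrightarrow> set q = set p \<Longrightarrow> stuck q x"
  by (simp add: stuck_def)

lemma stuck_rev: "stuck p x \<Longrightarrow> stuck (rev p) x"
  by (simp add: stuck_def is_cycle_rev)

lemma stuck_no_cycle: "stuck p x \<Longrightarrow> is_cycle q \<Longrightarrow> set p \<subseteq> set q \<Longrightarrow> x \<in> set q \<Longrightarrow> False"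
  by (auto simp: stuck_def blocked_def)

lemma stuck_no_insert:
  assumes "stuck p x" "w \<in> set p" "distinct q" "set q \<inter> set p = {}" "x \<in> set q"
    "successively adj (w # q @ [nxt p w])"
  shows False
  using cycle_insert[OF stuck_cycle[OF assms(1)] assms(2-4,6)] stuck_no_cycle[OF assms(1)] assms(5)
  by (metis Un_iff Un_upper1)

lemma stuck_no_cross:
  assumes "stuck p x" "w \<in> set p" "w' \<in> set p" "w \<noteq> w'" "distinct q" "set q \<inter> set p = {}"
    "x \<in> set q" "successively adj (w # q @ [w'])"
  shows "\<not> adj (nxt p w) (nxt p w')"
  using cycle_cross[OF stuck_cycle[OF assms(1)] assms(2-6,8)] stuck_no_cycle[OF assms(1)] assms(7)
  by (metis Un_iff Un_upper1)

text \<open>Otherwise \<open>x\<close> could be inserted between \<open>w\<close> and its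
  successor.\<close>

lemma stuck_not_adj_nxt:
  assumes "stuck p x" "w \<in> set p" "adj x w" shows "\<not> adj x (nxt p w)"
  using stuck_no_insert[OF assms(1,2), of "[x]"] stuck_notin[OF assms(1)] assms(3) by (auto simp: insert_commute)

text \<open>An edge between the two successors would allow a crossing along the path
  \<open>w, x, w'\<close>.\<close>

lemma stuck_nxt_indep:
  assumes "stuck p x" "w \<in> set p" "adj x w" "w' \<in> set p" "adj x w'"
  shows "\<not> adj (nxt p w) (nxt p w')"
proof (cases "w = w'")
  case True then show ?thesis using adj_verts by blast
next
  case False
  then show ?thesis
    using stuck_no_cross[OF assms(1,2,4), of "[x]"] stuck_notin[OF assms(1)] assms by (auto simp: insert_commute)
qed

text \<open>Off the cycle, \<open>y\<close> would give the detour
  \<open>w, x, y, nxt p w\<close>.\<close>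

lemma stuck_common:
  assumes "stuck p x" "w \<in> set p" "adj x w" "adj x y" "adj y (nxt p w)"
  shows "y \<in> set p"
proof (rule ccontr)
  assume "y \<notin> set p"
  then show False
    using stuck_no_insert[OF assms(1,2), of "[x, y]"] stuck_notin[OF assms(1)] assms adj_verts
    by (auto simp: insert_commute)
qed

text \<open>Summed over the attachments \<open>w\<close> of \<open>x\<close>, both sides of the second equation count the adjacent
  pairs of an attachment and a successor of an attachment; the degree condition gives
  \<open>\<ge>\<close> termwise, so all the inequalities involved are equalities.\<close>

lemma stuck_tight:
  assumes st: "stuck p x" and w: "w \<in> set p" "adj x w"
  shows "M w - (N x \<union> N (nxt p w)) = insert x (N w \<inter> nxt p ` (N x \<inter> set p))" (is ?tight)
    and "card (N x \<inter> set p \<inter> N (nxt p w)) = card (N w \<inter> nxt p ` (N x \<inter> set p))" (is ?eq)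
proof -
  let ?s = "nxt p"
  define W where "W = N x \<inter> set p"
  have W: "w \<in> W \<longleftrightarrow> w \<in> set p \<and> adj x w" for w by (auto simp: W_def)
  have finW: "finite W" by (simp add: W_def)
  have inj: "inj_on ?s W" using inj_on_nxt[OF stuck_distinct[OF st]] by (auto simp: W_def inj_on_def)
  have sp: "?s w \<in> set p" if "w \<in> W" for w
    using nxt_in_set[OF stuck_distinct[OF st]] that W by auto
  \<comment> \<open>The easy inclusion of the first equation: \<open>x\<close> and the successors of
    attachments are independent.\<close>
  have sub: "insert x (N w \<inter> ?s ` W) \<subseteq> M w - (N x \<union> N (?s w))" if "w \<in> W" for w
  proof
    fix v assume "v \<in> insert x (N w \<inter> ?s ` W)"
    then consider "v = x" | w' where "adj w v" "w' \<in> W" "v = ?s w'" by auto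
    then show "v \<in> M w - (N x \<union> N (?s w))"
    proof cases
      case 1
      have "x \<in> M w" using that W M_adj adj_sym by blast
      then show ?thesis
        using 1 stuck_not_adj_nxt[OF st, of w] that W adj_verts by (auto simp: insert_commute)
    next
      case 2
      then show ?thesis
        using M_adj stuck_not_adj_nxt[OF st, of w'] stuck_nxt_indep[OF st, of w w'] that W by auto
    qed
  qed
  have common: "N x \<inter> N (?s w) = W \<inter> N (?s w)" if "w \<in> W" for w
  proof -
    have "y \<in> set p" if "adj x y" "adj (?s w) y" for y
      using stuck_common[OF st, of w y] \<open>w \<in> W\<close> W that adj_sym by blast
    then show ?thesis unfolding W_def neighbours_def by blast
  qed
  have ge: "card (N w \<inter> ?s ` W) + 1 = card (insert x (N w \<inter> ?s ` W))" for w
    using sp stuck_notin[OF st] by (subst card_insert_disjoint) (auto simp: finW)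
  have le: "card (insert x (N w \<inter> ?s ` W)) \<le> card (M w - (N x \<union> N (?s w)))" if "w \<in> W" for w
    using sub[OF that] finite_M[of w] that W cycle_verts[OF stuck_cycle[OF st]]
    by (intro card_mono) auto
  have ore': "card (M w - (N x \<union> N (?s w))) \<le> card (W \<inter> N (?s w)) + 1" if "w \<in> W" for w
  proof -
    have "x \<noteq> ?s w" using sp[OF that] stuck_notin[OF st] by auto
    then show ?thesis
      using local_ore[of x w "?s w"] adj_nxt[OF stuck_cycle[OF st], of w]
        stuck_not_adj_nxt[OF st, of w] that W common[OF that] by simp
  qed
  have a: "card (N w \<inter> ?s ` W) \<le> card (W \<inter> N (?s w))" if "w \<in> W" for w
    using ge[of w] le[OF that] ore'[OF that] by linarith
  have c1: "card (W \<inter> N (?s w)) = (\<Sum>w'\<in>W. if adj (?s w) w' then 1 else 0)" for w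
    by (subst sum.If_cases[OF finW]) (simp add: neighbours_def)
  have c2: "card (N w \<inter> ?s ` W) = (\<Sum>w'\<in>W. if adj (?s w') w then 1 else 0)" for w
  proof -
    have "N w \<inter> ?s ` W = ?s ` (W \<inter> {w'. adj (?s w') w})" by (auto simp: insert_commute)
    then have "card (N w \<inter> ?s ` W) = card (W \<inter> {w'. adj (?s w') w})"
      using inj by (simp add: card_image inj_on_def)
    then show ?thesis by (subst sum.If_cases[OF finW]) simp
  qed
  have "(\<Sum>w\<in>W. card (N w \<inter> ?s ` W)) = (\<Sum>w\<in>W. card (W \<inter> N (?s w)))"
    unfolding c1 c2 by (rule sum.swap)
  then have eq: "card (N w \<inter> ?s ` W) = card (W \<inter> N (?s w))"
    using sum_mono_inv[of "\<lambda>w. card (N w \<inter> ?s ` W)" W] a w W finW by blast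
  then show ?eq by (simp add: W_def)
  have wW: "w \<in> W" using w W by simp
  have "finite (M w - (N x \<union> N (?s w)))"
    using finite_M[of w] w cycle_verts[OF stuck_cycle[OF st]] by auto
  then have "insert x (N w \<inter> ?s ` W) = M w - (N x \<union> N (?s w))"
    using sub[OF wW] eq ge[of w] ore'[OF wW] by (intro card_seteq) auto
  then show ?tight by (simp add: W_def)
qed

text \<open>The tightness equation as a case distinction. Later arguments apply it to
  \<open>p\<close> and to \<open>rev p\<close> and exclude all alternatives but one.\<close>

lemma stuck_tightE:
  assumes "stuck p x" "w \<in> set p" "adj x w" "v \<in> M w"
  obtains "v = x" | "adj x v" | "adj (nxt p w) v"
    | w' where "adj w v" "w' \<in> set p" "adj x w'" "v = nxt p w'"
proof (cases "v \<in> N x \<union> N (nxt p w)")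
  case True
  then show thesis using that(2,3) by auto
next
  case False
  then have "v \<in> insert x (N w \<inter> nxt p ` (N x \<inter> set p))"
    using stuck_tight(1)[OF assms(1-3)] assms(4) by blast
  then show thesis using that(1,4) by auto
qed

text \<open>If \<open>N x \<inter> set p\<close> has maximal size among the cycles through a given set, then no neighbour of
  \<open>x\<close> can be added to the cycle either, so that the tightness facts also hold for these
  neighbours.\<close>

definition maxstuck :: "'a list \<Rightarrow> 'a \<Rightarrow> bool" where
  "maxstuck p x \<longleftrightarrow> stuck p x \<and> (\<forall>a. adj x a \<longrightarrow> a \<notin> set p \<longrightarrow> blocked (set p) a)"

section \<open>Maximal stuck cycles alternate between attachments and other vertices\<close>

lemma maxstuck_stuck: "maxstuck p x \<Longrightarrow> stuck p x" by (simp add: maxstuck_def)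

lemma maxstuck_rev: "maxstuck p x \<Longrightarrow> maxstuck (rev p) x"
  by (simp add: maxstuck_def stuck_rev)

text \<open>If \<open>u = nxt p w\<close> were far from the other attachments, tightness would leave
  only \<open>x\<close>, \<open>u\<close> and their neighbours in \<open>M w\<close>, with
  \<open>w\<close> as the only common neighbour of \<open>x\<close> and \<open>u\<close>. A path
  from \<open>x\<close> to \<open>u\<close> in the ball without \<open>w\<close> then leaves the
  closed neighbourhood of \<open>x\<close> at an edge from \<open>a\<close> to \<open>b\<close>. By
  maximality \<open>a\<close> is stuck as well, and tightness for \<open>a\<close> at
  \<open>w\<close> fails, since \<open>u\<close> has two neighbours \<open>w\<close> and
  \<open>b\<close> among the attachments of \<open>a\<close>.\<close>

lemma maxstuck_not_isolated:
  assumes ms: "maxstuck p x" and w: "w \<in> set p" "adj x w"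
    and iso: "\<And>w'. w' \<in> set p \<Longrightarrow> adj x w' \<Longrightarrow> w' \<noteq> w \<Longrightarrow> nxt p w \<notin> M w'"
  shows False
proof -
  note st = maxstuck_stuck[OF ms]
  define u where "u = nxt p w"
  have up: "u \<in> set p" using nxt_in_set stuck_distinct[OF st] w by (simp add: u_def)
  have wu: "adj w u" using adj_nxt[OF stuck_cycle[OF st]] w by (simp add: u_def)
  have wV: "w \<in> verts G" using wu adj_verts by blast
  have xp: "x \<notin> set p" using stuck_notin[OF st] .
  have xu: "\<not> adj x u" using stuck_not_adj_nxt[OF st w] by (simp add: u_def)
  have inj: "nxt p a = nxt p b \<Longrightarrow> a \<in> set p \<Longrightarrow> b \<in> set p \<Longrightarrow> a = b" for a b
    using inj_on_nxt[OF stuck_distinct[OF st]] by (auto simp: inj_on_def)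
  have Wu: "N x \<inter> set p \<inter> N u = {w}"
  proof -
    have "w' = w" if "w' \<in> set p" "adj x w'" "adj u w'" for w'
      using iso[of w'] that M_adj[of w' u] by (auto simp: u_def insert_commute)
    then have "N x \<inter> set p \<inter> N u \<subseteq> {w}" unfolding neighbours_def by blast
    then show ?thesis using w adj_sym[OF wu] by auto
  qed
  have "card (N w \<inter> nxt p ` (N x \<inter> set p)) = 1"
    using stuck_tight(2)[OF st w] Wu by (simp add: u_def)
  moreover have "u \<in> N w \<inter> nxt p ` (N x \<inter> set p)" using w wu by (auto simp: u_def)
  ultimately have wW: "N w \<inter> nxt p ` (N x \<inter> set p) = {u}"
    by (metis card_1_singletonE singletonD)
  have Mw: "v = x \<or> adj x v \<or> adj u v \<or> v = u" if "v \<in> M w" for v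
  proof (rule ccontr)
    assume no: "\<not> (v = x \<or> adj x v \<or> adj u v \<or> v = u)"
    then have "v \<in> M w - (N x \<union> N (nxt p w))" using that by (simp add: u_def)
    then have "v \<in> insert x {u}" unfolding stuck_tight(1)[OF st w] wW .
    then show False using no by simp
  qed
  have com: "y = w" if "adj x y" "adj y u" for y
  proof -
    have "y \<in> set p" using stuck_common[OF st w that(1)] that(2) by (simp add: u_def)
    then have "y \<in> N x \<inter> set p \<inter> N u" using that adj_sym by auto
    then show "y = w" using Wu by blast
  qed
  have far: "nxt p w' \<notin> M w" if "w' \<in> set p" "adj x w'" "w' \<noteq> w" for w'
    using Mw[of "nxt p w'"] stuck_not_adj_nxt[OF st that(1,2)] stuck_nxt_indep[OF st w that(1,2)]
      nxt_in_set[OF stuck_distinct[OF st] that(1)] xp inj[of w' w] that w by (auto simp: u_def)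
  have "(\<lambda>a b. adj a b \<and> a \<in> M w - {w} \<and> b \<in> M w - {w})\<^sup>*\<^sup>* x u"
    using punctured_ball_connected[OF wV wV, of x u] M_adj[of w x] M_adj[OF wu] wu w adj_sym adj_verts
    by blast
  from rtranclp_crossing[OF this, of "\<lambda>v. v = x \<or> adj x v"] xu up xp
  obtain a b where ab: "adj a b" "a \<in> M w" "a \<noteq> w" "b \<in> M w" "b \<noteq> w"
    "a = x \<or> adj x a" "b \<noteq> x" "\<not> adj x b" by auto
  have xa: "adj x a" using ab by auto
  \<comment> \<open>On the cycle, \<open>a\<close> would be an attachment other than
    \<open>w\<close> at distance at most 2 from \<open>u\<close>, by way of
    \<open>b\<close>.\<close>
  have a_notin: "a \<notin> set p"
  proof
    assume "a \<in> set p"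
    moreover have "adj b u" using Mw[OF ab(4)] ab com xa adj_sym by blast
    ultimately show False using iso[OF _ xa] ab M_adj2[of a b u] by (auto simp: u_def)
  qed
  text \<open>Such a vertex \<open>c\<close> together with \<open>w, x, a\<close> gives a detour of the cycle unless its successor
    is far from \<open>w\<close>.\<close>
  have Q: "adj u c \<and> c \<in> set p \<and> nxt p c \<notin> M w"
    if c: "adj a c" "c \<noteq> w" "c \<noteq> x" "c \<in> M w" "\<not> adj x c" for c
  proof -
    have "c \<noteq> u" using com[OF xa] c ab by auto
    then have uc: "adj u c" using Mw[OF c(4)] c by auto
    have cp: "c \<in> set p"
    proof (rule ccontr)
      assume "c \<notin> set p"
      then show False
        using stuck_no_insert[OF st w(1), of "[x, a, c]"] c xa ab a_notin xp uc w adj_verts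
        by (auto simp: u_def insert_commute)
    qed
    have nu: "nxt p c \<noteq> u" using inj[of c w] cp w c by (auto simp: u_def)
    have "\<not> adj x (nxt p c)"
      using stuck_no_insert[OF st cp, of "[a, x]"] c xa a_notin xp adj_verts by (auto simp: insert_commute)
    moreover have "\<not> adj u (nxt p c)"
      using stuck_no_cross[OF st w(1) cp, of "[x, a]"] c xa a_notin xp w adj_verts
      by (auto simp: u_def insert_commute)
    moreover have "nxt p c \<noteq> x" using nxt_in_set[OF stuck_distinct[OF st] cp] xp by auto
    ultimately show ?thesis using Mw nu uc cp by blast
  qed
  have b: "adj u b" "b \<in> set p" "nxt p b \<notin> M w" using Q[of b] ab by auto
  \<comment> \<open>Here maximality is used: \<open>a\<close> is a neighbour of \<open>x\<close> off
    the cycle, hence blocked, and \<open>b\<close> is an attachment of it.\<close>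
  have sta: "stuck p a"
    using ms xa a_notin ab b by (auto simp: maxstuck_def stuck_def)
  have "w \<in> M b" using M_adj2[of b u w] b wu adj_sym by blast
  \<comment> \<open>Tightness for \<open>a\<close> at \<open>b\<close>, applied to the vertex
    \<open>w\<close>. All other alternatives would bring \<open>nxt p b\<close> into
    \<open>M w\<close>.\<close>
  then have "adj a w"
  proof (rule stuck_tightE[OF sta b(2) ab(1)])
    show "adj a w" if "w = a" using ab that by auto
    show "adj a w" if "adj (nxt p b) w" using M_adj[of w "nxt p b"] that b by (auto simp: insert_commute)
    show "adj a w" if "adj b w"
      using M_adj2[of w b "nxt p b"] that b adj_nxt[OF stuck_cycle[OF st]] adj_sym by blast
  qed auto
  have "c = w" if "c \<in> set p" "adj a c" "adj w (nxt p c)" for c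
  proof (rule ccontr)
    assume "c \<noteq> w"
    have cM: "c \<in> M w" using M_adj2[of w a c] \<open>adj a w\<close> that adj_sym by blast
    show False
    proof (cases "adj x c")
      case True
      then show False using far[of c] that \<open>c \<noteq> w\<close> M_adj[of w "nxt p c"] by auto
    next
      case False
      then show False using Q[of c] cM that \<open>c \<noteq> w\<close> xp M_adj[of w "nxt p c"] by auto
    qed
  qed
  \<comment> \<open>So only one successor of an attachment of \<open>a\<close> is adjacent to
    \<open>w\<close>, and the counting equation contradicts the presence of both \<open>w\<close>
    and \<open>b\<close>.\<close>
  then have "N w \<inter> nxt p ` (N a \<inter> set p) \<subseteq> {u}" unfolding u_def neighbours_def by blast
  then have "card (N w \<inter> nxt p ` (N a \<inter> set p)) \<le> 1"
    using card_mono[of "{u}"] by simp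
  then have "card (N a \<inter> set p \<inter> N u) \<le> 1"
    using stuck_tight(2)[OF sta w(1) \<open>adj a w\<close>] by (simp add: u_def)
  moreover have "{w, b} \<subseteq> N a \<inter> set p \<inter> N u" using \<open>adj a w\<close> w ab b wu by (auto simp: insert_commute)
  then have "card {w, b} \<le> card (N a \<inter> set p \<inter> N u)" by (intro card_mono) auto
  ultimately show False using ab by simp
qed


lemma maxstuck_same_set: "maxstuck p x \<Longrightarrow> is_cycle q \<Longrightarrow> set q = set p \<Longrightarrow> maxstuck q x"
  unfolding maxstuck_def using stuck_same_set by metis

text \<open>With the chord, \<open>u = nxt p w\<close> would be far from every attachment
  \<open>w'\<close> other than \<open>w\<close>, contrary to \<open>maxstuck_not_isolated\<close>.
  Otherwise \<open>u\<close> is adjacent to the predecessor \<open>c\<close> of \<open>w'\<close>,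
  and there is a cycle through \<open>x\<close>: from the successor of \<open>u\<close> along
  \<open>p\<close> to \<open>c\<close>, then \<open>u, w, x, w'\<close>, along \<open>p\<close> to
  the predecessor of \<open>w\<close>, and back by the chord.\<close>

lemma maxstuck_no_chord:
  assumes ms: "maxstuck p x" and w: "w \<in> set p" "adj x w"
    and z: "\<not> adj x (nxt p (nxt p w))"
  shows "\<not> adj (nxt (rev p) w) (nxt p (nxt p w))"
proof
  assume chord: "adj (nxt (rev p) w) (nxt p (nxt p w))"
  note st = maxstuck_stuck[OF ms]
  note d = stuck_distinct[OF st]
  define u where "u = nxt p w"
  have up: "u \<in> set p" using nxt_in_set d w by (simp add: u_def)
  have xu: "\<not> adj x u" using stuck_not_adj_nxt[OF st w] by (simp add: u_def)
  have xp: "x \<notin> set p" using stuck_notin[OF st] .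
  show False
  proof (rule maxstuck_not_isolated[OF ms w])
    fix w' assume w': "w' \<in> set p" "adj x w'" "w' \<noteq> w"
    show "nxt p w \<notin> M w'"
    proof
      assume "nxt p w \<in> M w'"
      then have uM: "u \<in> M w'" by (simp add: u_def)
      have "adj u w'" using uM
      proof (rule stuck_tightE[OF st w'(1,2)])
        show "adj u w'" if "adj (nxt p w') u"
          using stuck_nxt_indep[OF st w'(1,2) w] that by (simp add: u_def)
      qed (use up xp xu in \<open>auto simp: insert_commute\<close>)
      define c where "c = nxt (rev p) w'"
      have w'r: "w' \<in> set (rev p)" using w' by simp
      have "adj c u" using uM
      proof (rule stuck_tightE[OF stuck_rev[OF st] w'r w'(2)])
        \<comment> \<open>If \<open>u\<close> preceded an attachment, this attachment would be the
          successor of \<open>u\<close>, which is not adjacent to \<open>x\<close>.\<close>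
        fix v assume v: "v \<in> set (rev p)" "adj x v" "u = nxt (rev p) v"
        then have "nxt p u = v" using nxt_nxt_rev[OF d, of v] by simp
        then show "adj c u" using z v by (simp add: u_def)
      qed (use up xp xu in \<open>auto simp: c_def\<close>)
      obtain r where r: "is_cycle (w # r)" "set (w # r) = set p"
        "\<And>a. a \<in> set p \<Longrightarrow> nxt (w # r) a = nxt p a" using cycle_from[OF stuck_cycle[OF st] w(1)] by blast
      have dr: "distinct (w # r)" using is_cycle_distinct[OF r(1)] .
      have "u = hd (r @ [w])" using nxt_Cons[OF dr] r(3) w by (simp add: u_def)
      moreover have "r \<noteq> []" using r(1) by (auto simp: is_cycle_def)
      ultimately obtain r' where r': "r = u # r'" by (cases r) auto
      have r'ne: "r' \<noteq> []" using r(1) by (auto simp: is_cycle_def r')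
      have z: "nxt p u = hd r'" "\<not> adj x (hd r')"
        using nxt_append[of "[w]" u r'] dr r' r(3)[of u] up r'ne z by (auto simp: u_def)
      have "nxt (w # r) (last r') = w"
        using nxt_append[of "w # u # butlast r'" "last r'" "[]"] dr r'ne by (simp add: r')
      moreover have lp: "last r' \<in> set p" using r(2) r'ne by (metis r' last_in_set list.set_intros(2))
      ultimately have "nxt p (last r') = w" using r(3) by simp
      then have "nxt (rev p) w = last r'" using nxt_rev_eq[OF d lp] by simp
      then have chord': "adj (last r') (hd r')" using chord z by (simp add: u_def)
      have "w' \<in> set r'" using w' r(2) xu r' by auto
      then obtain r1 r2 where r12: "r' = r1 @ w' # r2" by (meson split_list)
      have "r1 \<noteq> []" using z w' by (auto simp: r12)
      then obtain r0 c' where r0: "r1 = r0 @ [c']" by (metis rev_exhaust)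
      have "nxt (w # r) c' = w'"
        using nxt_append[of "w # u # r0" c' "w' # r2"] dr by (simp add: r' r12 r0)
      moreover have c'p: "c' \<in> set p" unfolding r(2)[symmetric] by (simp add: r' r12 r0)
      ultimately have "nxt p c' = w'" using r(3) by simp
      then have c': "c = c'" using nxt_rev_eq[OF d c'p] by (simp add: c_def)
      have "successively adj (([w, u] @ (r0 @ [c])) @ ((w' # r2) @ [w]))"
        using r(1) by (simp add: is_cycle_def r' r12 r0 c')
      then have sr: "successively adj (r0 @ [c])" "successively adj (w' # r2)"
        unfolding successively_append_iff[of _ "[w, u] @ (r0 @ [c])"]
          successively_append_iff[of _ "[w, u]"] successively_append_iff[of _ "w' # r2"] by auto
      have "successively adj ([c, u, w, x] @ (w' # r2))"
        using \<open>adj c u\<close> sr(2) w w' adj_nxt[OF stuck_cycle[OF st] w(1)]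
        unfolding successively_append_iff by (auto simp: u_def insert_commute)
      then have "successively adj (r0 @ ([c, u, w, x] @ (w' # r2)))"
        using sr(1) unfolding successively_append_iff[of _ r0] by auto
      moreover have "hd (r0 @ [c, u, w, x] @ w' # r2) = hd r'" "last (r0 @ [c, u, w, x] @ w' # r2) = last r'"
        by (auto simp: r12 r0 c' hd_append)
      ultimately have "successively adj ((r0 @ [c, u, w, x] @ w' # r2) @ [hd (r0 @ [c, u, w, x] @ w' # r2)])"
        using chord' unfolding successively_append_iff[of _ "r0 @ [c, u, w, x] @ w' # r2"] by simp
      then have "is_cycle (r0 @ [c, u, w, x] @ w' # r2)"
        using dr xp r(2) unfolding is_cycle_def by (auto simp: r' r12 r0 c')
      then show False
        by (rule stuck_no_cycle[OF st]) (auto simp: r(2)[symmetric] r' r12 r0 c')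
    qed
  qed
qed

text \<open>Write \<open>w, u, z, w'\<close> for consecutive vertices, \<open>z\<close> not adjacent
  to \<open>x\<close>. Tightness and the absence of chords make \<open>w'\<close> an attachment and
  give the edges from \<open>w\<close> to \<open>z\<close> and from \<open>u\<close> to
  \<open>w'\<close>. Exchanging \<open>u\<close> and \<open>z\<close> yields another stuck cycle, on
  which the predecessors of \<open>w\<close> and \<open>w'\<close> are adjacent.\<close>

lemma maxstuck_alternates:
  assumes ms: "maxstuck p x" and w: "w \<in> set p" "adj x w"
  shows "adj x (nxt p (nxt p w))"
proof (rule ccontr)
  assume no: "\<not> adj x (nxt p (nxt p w))"
  obtain r where r: "is_cycle (w # r)" "set (w # r) = set p"
    "\<And>a. a \<in> set p \<Longrightarrow> nxt (w # r) a = nxt p a"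
    using cycle_from[OF stuck_cycle[OF maxstuck_stuck[OF ms]] w(1)] by blast
  obtain u z r' where r': "r = u # z # r'" using r(1)
    by (cases r; cases "tl r") (auto simp: is_cycle_def)
  define q where "q = w # u # z # r'"
  have msq: "maxstuck q x" using maxstuck_same_set[OF ms r(1,2)] by (simp add: q_def r')
  note st = maxstuck_stuck[OF msq]
  note d = stuck_distinct[OF st]
  have n: "nxt q w = u" "nxt q u = z" "nxt q z = hd (r' @ [w])"
    using nxt_append[of "[]" w "u # z # r'"] nxt_append[of "[w]" u "z # r'"]
      nxt_append[of "[w,u]" z r'] d by (auto simp: q_def) (cases r'; auto)+
  have sq: "set q = set p" using r(2) by (simp add: q_def r')
  have pw: "nxt p w = u" using r(3)[of w] w n(1) by (simp add: q_def r')
  have "u \<in> set p" using sq by (auto simp: q_def)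
  then have pu: "nxt p u = z" using r(3)[of u] n(2) by (simp add: q_def r')
  have wq: "w \<in> set q" by (simp add: q_def)
  then have wqr: "w \<in> set (rev q)" by simp
  have no: "\<not> adj x z" using no pw pu by simp
  have xu: "\<not> adj x u" using stuck_not_adj_nxt[OF st wq w(2)] n by simp
  have xq: "x \<notin> set q" using stuck_notin[OF st] .
  have nochord: "\<not> adj (nxt (rev q) w) z"
    using maxstuck_no_chord[OF msq wq w(2)] n no by simp
  have wu: "adj w u" "adj u z"
    using adj_nxt[OF stuck_cycle[OF st], of w] adj_nxt[OF stuck_cycle[OF st], of u] n
    by (auto simp: q_def)
  have "z \<in> M w" using M_adj2 wu by blast
  \<comment> \<open>Tightness for the reversed cycle at \<open>w\<close>, applied to
    \<open>z\<close>. The third alternative is the excluded chord, so \<open>z\<close> is adjacent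
    to \<open>w\<close> and precedes an attachment.\<close>
  then have "adj w z \<and> adj x (nxt q z)"
  proof (rule stuck_tightE[OF stuck_rev[OF st] wqr w(2)])
    fix v assume v: "adj w z" "v \<in> set (rev q)" "adj x v" "z = nxt (rev q) v"
    then have "nxt q z = v" using nxt_nxt_rev[OF d, of v] by simp
    then show ?thesis using v by simp
  qed (use no nochord xq in \<open>auto simp: q_def\<close>)
  then have wz: "adj w z" and xw': "adj x (nxt q z)" by auto
  show False
  proof (cases r')
    case Nil
    show False
      \<comment> \<open>The cycle is a triangle with \<open>w\<close> as its only attachment, so the
        isolation hypothesis holds vacuously.\<close>
      by (rule maxstuck_not_isolated[OF msq wq w(2)]) (use Nil no xu in \<open>auto simp: q_def\<close>)
  next
    case (Cons w' r3)
    have n': "nxt q z = w'" using n Cons by simp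
    have w'q: "w' \<in> set q" by (simp add: q_def Cons)
    have rq: "nxt (rev q) w' = z" "nxt (rev q) z = u"
      using nxt_rev_eq[OF d, of z w'] nxt_rev_eq[OF d, of u z] n n' by (auto simp: q_def)
    \<comment> \<open>On the reversed cycle \<open>u\<close> comes two steps after
      \<open>w'\<close>, so the same chord argument applies from the other side.\<close>
    have "\<not> adj (nxt q w') u"
      using maxstuck_no_chord[OF maxstuck_rev[OF msq], of w'] w'q xw' n' rq xu by simp
    moreover have "u \<in> M w'"
    proof -
      have "adj z w'" using adj_nxt[OF stuck_cycle[OF st], of z] n' by (simp add: q_def)
      then show ?thesis using M_adj2[of w' z u] wu adj_sym by blast
    qed
    moreover have "adj x w'" using xw' n' by simp
    ultimately have uw': "adj w' u"
      using stuck_tight(1)[OF st w'q] xu xq by (auto simp: q_def)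
    define q' where "q' = w # z # u # w' # r3"
    have "successively adj (q @ [w])" using stuck_cycle[OF st] by (simp add: is_cycle_def q_def)
    then have "is_cycle q'"
      using d wz uw' wu stuck_cycle[OF st]
      by (auto simp: is_cycle_def q_def q'_def Cons insert_commute)
    then have st': "stuck q' x"
      by (rule stuck_same_set[OF st]) (auto simp: q_def q'_def Cons)
    note d' = stuck_distinct[OF st']
    obtain r4 t where r4: "w' # r3 = r4 @ [t]" by (metis list.distinct(1) rev_exhaust)
    have tq: "t \<in> set q" using r4 by (auto simp: q_def Cons)
    have "nxt q t = w" using nxt_append[of "w # u # z # r4" t "[]"] d by (simp add: q_def Cons r4)
    then have t: "nxt (rev q) w = t" using nxt_rev_eq[OF d tq] by simp
    have "nxt q' t = w" using nxt_append[of "w # z # u # r4" t "[]"] d' by (simp add: q'_def r4)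
    then have t': "nxt (rev q') w = t"
      using nxt_rev_eq[OF d', of t] tq by (auto simp: q_def q'_def Cons)
    have u': "nxt (rev q') w' = u"
      using nxt_append[of "[w, z]" u "w' # r3"] d' nxt_rev_eq[OF d', of u w'] by (auto simp: q'_def)
    have "u \<in> M w" using M_adj wu by blast
    \<comment> \<open>Tightness for the reversal of the original cycle at \<open>w\<close>, applied
      to \<open>u\<close>; \<open>t\<close> is the predecessor of \<open>w\<close> on both
      cycles.\<close>
    then have "adj t u"
    proof (rule stuck_tightE[OF stuck_rev[OF st] wqr w(2)])
      fix v assume v: "v \<in> set (rev q)" "adj x v" "u = nxt (rev q) v"
      then have "nxt q u = v" using nxt_nxt_rev[OF d, of v] by simp
      then show "adj t u" using v n no by simp
    qed (use xu xq t in \<open>auto simp: q_def\<close>)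
    then show False
      using stuck_nxt_indep[OF stuck_rev[OF st'], of w w'] w xw' n' t' u'
      by (auto simp: q'_def)
  qed
qed

text \<open>With \<open>u = nxt p w\<close> and \<open>v = nxt p u\<close>, the vertex
  \<open>y\<close> has distance at most 2 from \<open>v\<close>, and tightness at \<open>v\<close>
  applies. The critical case is that \<open>y\<close> is adjacent to the successor of
  \<open>v\<close>: then \<open>w, x, v, u, y\<close> can replace the segment
  \<open>w, u, v\<close>.\<close>

lemma stuck_neighbour_between:
  assumes st: "stuck p x" and w: "w \<in> set p" "adj x w" "adj x (nxt p (nxt p w))"
    and y: "y \<noteq> x" "adj y (nxt p w)"
  shows "y \<in> set p"
proof (rule ccontr)
  assume yp: "y \<notin> set p"
  obtain r where r: "is_cycle (w # r)" "set (w # r) = set p"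
    "\<And>a. a \<in> set p \<Longrightarrow> nxt (w # r) a = nxt p a"
    using cycle_from[OF stuck_cycle[OF st] w(1)] by blast
  obtain u v r' where r': "r = u # v # r'" using r(1)
    by (cases r; cases "tl r") (auto simp: is_cycle_def)
  define q where "q = w # u # v # r'"
  have stq: "stuck q x" using stuck_same_set[OF st r(1,2)] by (simp add: q_def r')
  note d = stuck_distinct[OF stq]
  have n: "nxt q w = u" "nxt q u = v" "nxt q v = hd (r' @ [w])"
    using nxt_append[of "[]" w "u # v # r'"] nxt_append[of "[w]" u "v # r'"]
      nxt_append[of "[w,u]" v r'] d by (auto simp: q_def) (cases r'; auto)+
  have sq: "set q = set p" using r(2) by (simp add: q_def r')
  have pw: "nxt p w = u" using r(3)[of w] w n(1) by (simp add: q_def r')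
  have "u \<in> set p" using sq by (auto simp: q_def)
  then have pu: "nxt p u = v" using r(3)[of u] n(2) by (simp add: q_def r')
  have xv: "adj x v" using w(3) pw pu by simp
  have yu: "adj y u" using y pw by simp
  have yq: "y \<notin> set q" "x \<notin> set q" using yp sq stuck_notin[OF stq] by auto
  have wq: "w \<in> set q" "v \<in> set q" "u \<in> set q" by (auto simp: q_def)
  have uv: "adj u v" using adj_nxt[OF stuck_cycle[OF stq] wq(3)] n by simp
  have "y \<in> M v" using M_adj2[of v u y] uv yu adj_sym by blast
  then show False
  proof (rule stuck_tightE[OF stq wq(2) xv])
    assume "adj x y"
    then show False using stuck_common[OF stq wq(1) w(2)] yu n yq by simp
  next
    fix w' assume "w' \<in> set q" "y = nxt q w'"
    then show False using nxt_in_set[OF d] yq by auto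
  next
    assume "adj (nxt q v) y"
    then have a: "adj y (hd (r' @ [w]))" using n adj_sym by simp
    have "successively adj (q @ [w])" using stuck_cycle[OF stq] by (simp add: is_cycle_def q_def)
    then have "successively adj (r' @ [w])" by (cases r') (auto simp: q_def)
    then have "successively adj ([w, x, v, u, y] @ (r' @ [w]))"
      using a w(2) xv uv yu unfolding successively_append_iff by (auto simp: insert_commute)
    then have "is_cycle ([w, x, v, u, y] @ r')"
      using d yq y(1) by (auto simp: is_cycle_def q_def)
    from stuck_no_cycle[OF stq this] show False by (auto simp: q_def)
  qed (use y in auto)
qed

text \<open>By alternation the cycle consists of attachments and their successors. No edge leaves
  \<open>insert x (set p)\<close>, so by connectedness this finite set would contain all
  vertices.\<close>

lemma not_maxstuck: "\<not> maxstuck p x"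
proof
  assume ms: "maxstuck p x"
  note st = maxstuck_stuck[OF ms]
  note d = stuck_distinct[OF st]
  obtain w0 where w0: "w0 \<in> set p" "adj x w0" using st by (auto simp: stuck_def)
  define W where "W = {w \<in> set p. adj x w}"
  have "set p \<subseteq> W \<union> nxt p ` W"
  proof (rule set_subset_nxt_closed[OF d w0(1)])
    fix v assume "v \<in> set p" "v \<in> W \<union> nxt p ` W"
    then show "nxt p v \<in> W \<union> nxt p ` W"
      using maxstuck_alternates[OF ms] nxt_in_set[OF d] by (auto simp: W_def)
  qed (use w0 in \<open>auto simp: W_def\<close>)
  then have cov: "v \<in> W \<or> (\<exists>w\<in>W. v = nxt p w)" if "v \<in> set p" for v using that by auto
  have "y \<in> set p" if "adj x y" for y
  proof (rule ccontr)
    assume yp: "y \<notin> set p"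
    obtain r where r: "is_cycle (w0 # r)" "set (w0 # r) = set p"
      "\<And>a. a \<in> set p \<Longrightarrow> nxt (w0 # r) a = nxt p a"
      using cycle_from[OF stuck_cycle[OF st] w0(1)] by blast
    obtain u v r' where r': "r = u # v # r'" using r(1)
      by (cases r; cases "tl r") (auto simp: is_cycle_def)
    have dr: "distinct (w0 # u # v # r')" using is_cycle_distinct[OF r(1)] r' by simp
    have "nxt (w0 # r) w0 = u" "nxt (w0 # r) u = v"
      using nxt_append[of "[]" w0 "u # v # r'"] nxt_append[of "[w0]" u "v # r'"] dr
      by (auto simp: r')
    moreover have "u \<in> set p" using r r' by auto
    ultimately have n: "nxt p w0 = u" "nxt p u = v" using r(3) w0 by auto
    have xv: "adj x v" using maxstuck_alternates[OF ms w0] n by simp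
    have xp: "x \<notin> set p" using stuck_notin[OF st] .
    have xu: "\<not> adj x u" using stuck_not_adj_nxt[OF st w0] n by simp
    \<comment> \<open>For the neighbours of \<open>x\<close> itself, \<open>x\<close> and
      \<open>u\<close> exchange roles: \<open>u\<close> is stuck at the cycle \<open>q\<close>, on
      which \<open>x\<close> lies between the two attachments \<open>w0\<close> and \<open>v\<close>
      of \<open>u\<close>.\<close>
    define q where "q = w0 # x # v # r'"
    have cq: "is_cycle q" using r(1) w0 xv xp r(2)
      by (auto simp: is_cycle_def q_def r' insert_commute)
    have "stuck q u"
    proof -
      have "adj w0 u" using r(1) by (simp add: is_cycle_def r')
      then have "N u \<inter> set q \<noteq> {}" by (auto simp: q_def insert_commute)
      moreover have "u \<notin> set c" if "is_cycle c" "set q \<subseteq> set c" for c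
      proof
        assume "u \<in> set c"
        then have "set p \<subseteq> set c" using that(2) unfolding r(2)[symmetric] by (auto simp: q_def r')
        then show False using stuck_no_cycle[OF st that(1)] that(2) by (auto simp: q_def)
      qed
      ultimately show ?thesis using cq by (auto simp: stuck_def blocked_def)
    qed
    moreover have nq: "nxt q w0 = x" "nxt q x = v"
      using nxt_append[of "[]" w0 "x # v # r'"] nxt_append[of "[w0]" x "v # r'"] is_cycle_distinct[OF cq]
      by (auto simp: q_def)
    moreover have "w0 \<in> set q" by (simp add: q_def)
    moreover have "adj u w0" "adj u v" using r(1) by (auto simp: is_cycle_def r' insert_commute)
    moreover have "y \<noteq> u" using that xu by auto
    moreover have "adj y x" using that adj_sym by simp
    ultimately have "y \<in> set q" using stuck_neighbour_between[of q u w0 y] by auto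
    moreover have "y \<noteq> x" using \<open>adj y x\<close> by auto
    ultimately show False using yp r(2) by (auto simp: q_def r')
  qed
  moreover have "y \<in> insert x (set p)" if "v \<in> set p" "adj v y" for v y
  proof -
    \<comment> \<open>Successors of attachments lie between two attachments; for attachments
      themselves, tightness reduces the claim to this case and to the neighbours of
      \<open>x\<close>.\<close>
    have *: "y \<in> insert x (set p)" if "w \<in> W" "adj (nxt p w) y" for w y
      using stuck_neighbour_between[OF st, of w y] maxstuck_alternates[OF ms, of w] that
      by (auto simp: W_def insert_commute)
    show ?thesis
    proof (cases "v \<in> W")
      case True
      then have v: "v \<in> set p" "adj x v" by (auto simp: W_def)
      from M_adj[OF that(2)] show ?thesis
      proof (rule stuck_tightE[OF st v])
        assume "adj x y" then show ?thesis using calculation by blast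
      next
        assume "adj (nxt p v) y" then show ?thesis using * True by blast
      qed (use nxt_in_set[OF d] in auto)
    next
      case False
      then show ?thesis using cov[OF that(1)] * that(2) by auto
    qed
  qed
  ultimately have closed: "y \<in> insert x (set p)" if "v \<in> insert x (set p)" "adj v y" for v y
    using that by auto
  have "verts G \<subseteq> insert x (set p)"
  proof
    fix v assume "v \<in> verts G"
    then have "adj\<^sup>*\<^sup>* x v" using reachable w0 adj_verts by blast
    then show "v \<in> insert x (set p)"
    proof (induction rule: rtranclp_induct)
      case (step y z) then show ?case using closed by blast
    qed simp
  qed
  then show False using infinite finite_subset by blast
qed

section \<open>Cycles through arbitrary finite sets\<close>

lemma cycle_extend:
  assumes p: "is_cycle p" and x: "w \<in> set p" "adj x w"
  shows "\<exists>q. is_cycle q \<and> insert x (set p) \<subseteq> set q"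
proof (rule ccontr)
  assume "\<nexists>q. is_cycle q \<and> insert x (set p) \<subseteq> set q"
  then have bl: "blocked (set p) x" by (auto simp: blocked_def)
  define A where "A = {q. is_cycle q \<and> set p \<subseteq> set q}"
  define f where "f q = card (N x \<inter> set q)" for q
  have "f q \<le> card (N x)" for q unfolding f_def by (intro card_mono) auto
  then have "f ` A \<subseteq> {..card (N x)}" by blast
  then have "finite (f ` A)" by (rule finite_subset) simp
  moreover have "p \<in> A" using p by (simp add: A_def)
  \<comment> \<open>Among the cycles through \<open>set p\<close>, one with the most neighbours of
    \<open>x\<close> is chosen; the maximum exists because \<open>x\<close> has finite
    degree.\<close>
  ultimately obtain q where q: "q \<in> A" "\<And>q'. q' \<in> A \<Longrightarrow> f q' \<le> f q"
    using Max_in[of "f ` A"] Max_ge[of "f ` A"] by (metis empty_iff image_eqI imageE)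
  have st: "stuck q x"
    using q(1) bl x by (auto simp: stuck_def A_def blocked_def)
  have "blocked (set q) a" if "adj x a" "a \<notin> set q" for a
  proof -
    have "a \<notin> set q'" if q': "is_cycle q'" "set q \<subseteq> set q'" for q'
    proof
      assume "a \<in> set q'"
      then have "f q < f q'"
        using \<open>adj x a\<close> \<open>a \<notin> set q\<close> q'(2) unfolding f_def by (intro psubset_card_mono) auto
      moreover have "q' \<in> A" using q' q(1) by (auto simp: A_def)
      ultimately show False using q(2) by fastforce
    qed
    then show ?thesis by (auto simp: blocked_def)
  qed
  \<comment> \<open>A larger cycle containing a further neighbour of \<open>x\<close> would
    contradict the choice of \<open>q\<close>, so all such neighbours are blocked.\<close>
  then have "maxstuck q x" using st by (auto simp: maxstuck_def)
  then show False using not_maxstuck by blast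
qed

text \<open>Some vertex \<open>w\<close> has two neighbours, and the ball around \<open>w\<close>
  stays connected without \<open>w\<close>; a path in it between the two neighbours closes up
  through \<open>w\<close>.\<close>

lemma exists_cycle: "\<exists>p. is_cycle p"
proof -
  obtain w where w: "w \<in> verts G" using infinite by (metis finite.emptyI ex_in_conv)
  have "\<not> verts G \<subseteq> {w}" using infinite finite_subset by blast
  then obtain v where "v \<in> verts G" "v \<noteq> w" by blast
  from reachable[OF w this(1)] this(2) obtain x where x: "adj w x"
    by (cases rule: converse_rtranclpE) auto
  have xV: "x \<in> verts G" "x \<noteq> w" using adj_verts x by blast+
  \<comment> \<open>The second neighbour comes from the ball without \<open>x\<close>, which is
    connected and contains more than \<open>w\<close>.\<close>
  obtain u where u: "adj w u" "u \<noteq> x"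
  proof -
    have vB: "verts (graph_ball G 2 w) = M w"
      by (auto simp: graph_ball_def induced_subgraph_def ball_verts_def)
    have "\<not> is_singleton (verts (delete_verts (graph_ball G 2 w) {x}))"
      using ball_2_connected[OF w] M_adj[OF x] vB by (auto simp: k_connected_def)
    moreover have "verts (delete_verts (graph_ball G 2 w) {x}) = M w - {x}"
      using vB by (auto simp: delete_verts_def induced_subgraph_def)
    ultimately have "M w - {x} \<noteq> {w}" by (metis is_singletonI)
    then obtain y where y: "y \<in> M w - {x}" "y \<noteq> w" using M_self[OF w] xV by blast
    have "(\<lambda>a b. adj a b \<and> a \<in> M w - {x} \<and> b \<in> M w - {x})\<^sup>*\<^sup>* w y"
      using punctured_ball_connected[OF w xV(1)] y M_self[OF w] xV by blast
    then show thesis using that y by (cases rule: converse_rtranclpE) auto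
  qed
  have "(\<lambda>a b. adj a b \<and> a \<in> M w - {w} \<and> b \<in> M w - {w})\<^sup>*\<^sup>* x u"
    using punctured_ball_connected[OF w w] x u M_adj adj_verts by blast
  from rtranclp_imp_distinct_path[OF this] obtain p where p: "p \<noteq> []" "distinct p"
    "successively (\<lambda>a b. adj a b \<and> a \<in> M w - {w} \<and> b \<in> M w - {w}) p" "hd p = x" "last p = u" by blast
  obtain p' where p': "p = x # p'" using p by (cases p) auto
  have "p' \<noteq> []" using p u p' by auto
  have sp: "successively adj p" using p(3) by (rule successively_mono) auto
  have "w \<notin> set p"
  proof
    assume "w \<in> set p"
    then obtain i where i: "i < length p" "p ! i = w" by (auto simp: in_set_conv_nth)
    then have "i = 0 \<or> (\<exists>j. i = Suc j)" by (cases i) auto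
    then show False
    proof
      assume "i = 0" then show False using i p' xV by simp
    next
      assume "\<exists>j. i = Suc j"
      then show False using p(3) i by (auto simp: successively_conv_nth)
    qed
  qed
  moreover have "successively adj ((w # p) @ [w])"
    unfolding successively_append_iff using sp p x u by (auto simp: p' insert_commute)
  moreover have "3 \<le> length (w # p)" using p' \<open>p' \<noteq> []\<close> by (cases p') auto
  ultimately have "is_cycle (w # p)" using p by (simp add: is_cycle_def)
  then show ?thesis by blast
qed

text \<open>To reach a further vertex \<open>s\<close>, the cycle is extended by one vertex at a
  time along a walk from the cycle to \<open>s\<close>.\<close>

theorem finite_subset_cycle:
  assumes "finite S" "S \<subseteq> verts G"
  shows "\<exists>p. is_cycle p \<and> S \<subseteq> set p"
  using assms
proof (induction rule: finite_induct)
  case empty then show ?case using exists_cycle by simp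
next
  case (insert s S)
  then obtain p where p: "is_cycle p" "S \<subseteq> set p" by auto
  then obtain v where v: "v \<in> set p" by (cases p) (auto simp: is_cycle_def)
  then have "adj\<^sup>*\<^sup>* v s" using reachable cycle_verts[OF p(1)] insert by blast
  then have "\<exists>q. is_cycle q \<and> insert s (set p) \<subseteq> set q"
  proof (induction rule: rtranclp_induct)
    case base then show ?case using p v by blast
  next
    case (step y z)
    then obtain q where q: "is_cycle q" "insert y (set p) \<subseteq> set q" by blast
    then obtain q' where "is_cycle q'" "insert z (set q) \<subseteq> set q'"
      using cycle_extend[of q y z] step adj_sym by blast
    then show ?case using q by blast
  qed
  then show ?case using p by blast
qed

end

section \<open>A limit of linear orders along cycles\<close>

text \<open>A diagonal argument: truth values are read as the reals 0 and 1, and a convergent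
  sequence of such values is eventually constant.\<close>

lemma eventually_const_subsequence:
  fixes P :: "nat \<Rightarrow> 'a \<Rightarrow> bool"
  assumes "countable S"
  obtains k where "strict_mono (k :: nat \<Rightarrow> nat)"
    "\<And>x. x \<in> S \<Longrightarrow> (\<forall>\<^sub>F n in sequentially. P (k n) x) \<or> (\<forall>\<^sub>F n in sequentially. \<not> P (k n) x)"
proof -
  define f :: "nat \<Rightarrow> 'a \<Rightarrow> real" where "f n x = of_bool (P n x)" for n x
  have "norm (f n x) \<le> 1" for n x by (simp add: f_def)
  then obtain k where k: "strict_mono (k :: nat \<Rightarrow> nat)"
    "\<And>x. x \<in> S \<Longrightarrow> \<exists>l. (\<lambda>n. f (k n) x) \<longlonglongrightarrow> l"
    using function_convergent_subsequence[OF assms, of f 1] by blast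
  show thesis
  proof (rule that[OF k(1)])
    fix x assume "x \<in> S"
    then obtain l where l: "(\<lambda>n. f (k n) x) \<longlonglongrightarrow> l" using k(2) by blast
    show "(\<forall>\<^sub>F n in sequentially. P (k n) x) \<or> (\<forall>\<^sub>F n in sequentially. \<not> P (k n) x)"
    proof (cases "0 < l")
      case True
      then have "\<forall>\<^sub>F n in sequentially. 0 < f (k n) x" using order_tendstoD(1)[OF l] by blast
      then show ?thesis by (auto simp: f_def)
    next
      case False
      then have "\<forall>\<^sub>F n in sequentially. f (k n) x < 1" using order_tendstoD(2)[OF l, of 1] by simp
      then show ?thesis by (auto simp: f_def elim!: eventually_mono)
    qed
  qed
qed

section \<open>The linear order of a list\<close>

definition before :: "'a list \<Rightarrow> 'a \<Rightarrow> 'a \<Rightarrow> bool" where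
  "before p u v \<longleftrightarrow> (\<exists>i j. i < j \<and> j < length p \<and> p ! i = u \<and> p ! j = v)"

definition just_before :: "'a list \<Rightarrow> 'a \<Rightarrow> 'a \<Rightarrow> bool" where
  "just_before p u v \<longleftrightarrow> (\<exists>i. Suc i < length p \<and> p ! i = u \<and> p ! Suc i = v)"

lemma before_irrefl: "distinct p \<Longrightarrow> \<not> before p u u"
  by (auto simp: before_def nth_eq_iff_index_eq)

lemma before_trans:
  assumes "distinct p" "before p u v" "before p v w" shows "before p u w"
proof -
  obtain i j where ij: "i < j" "j < length p" "p ! i = u" "p ! j = v"
    using assms(2) by (auto simp: before_def)
  obtain j' k where jk: "j' < k" "k < length p" "p ! j' = v" "p ! k = w"
    using assms(3) by (auto simp: before_def)
  have "j = j'" using ij jk assms(1) nth_eq_iff_index_eq[of p j j'] by auto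
  then show ?thesis using ij jk unfolding before_def by (intro exI[of _ i] exI[of _ k]) auto
qed

lemma before_total: "u \<in> set p \<Longrightarrow> v \<in> set p \<Longrightarrow> u \<noteq> v \<Longrightarrow> before p u v \<or> before p v u"
  unfolding before_def by (metis in_set_conv_nth linorder_neqE_nat)

lemma before_hd: "distinct p \<Longrightarrow> v \<in> set p \<Longrightarrow> v \<noteq> hd p \<Longrightarrow> before p (hd p) v"
  unfolding before_def by (metis gr0I hd_conv_nth in_set_conv_nth list.set(1) empty_iff)

lemma before_last:
  assumes "v \<in> set p" "v \<noteq> last p" shows "before p v (last p)"
proof -
  obtain i where i: "i < length p" "p ! i = v" using assms(1) by (auto simp: in_set_conv_nth)
  have "p \<noteq> []" using i by auto
  then have "i \<noteq> length p - 1" using i assms(2) by (auto simp: last_conv_nth)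
  then show ?thesis
    using i \<open>p \<noteq> []\<close> unfolding before_def
    by (intro exI[of _ i] exI[of _ "length p - 1"]) (auto simp: last_conv_nth)
qed

lemma just_before_before: "just_before p u v \<Longrightarrow> before p u v"
  unfolding just_before_def before_def by (metis lessI)

lemma just_before_least:
  assumes "distinct p" "just_before p u v" "before p u w" "w \<noteq> v" shows "before p v w"
proof -
  obtain i where i: "Suc i < length p" "p ! i = u" "p ! Suc i = v"
    using assms(2) by (auto simp: just_before_def)
  obtain j k where jk: "j < k" "k < length p" "p ! j = u" "p ! k = w"
    using assms(3) by (auto simp: before_def)
  have "i = j" using i jk assms(1) nth_eq_iff_index_eq[of p i j] by auto
  then have "Suc i < k" using i jk assms(4) by (metis Suc_lessI)
  then show ?thesis using i jk by (auto simp: before_def)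
qed

lemma just_before_greatest:
  assumes "distinct p" "just_before p u v" "before p w v" "w \<noteq> u" shows "before p w u"
proof -
  obtain i where i: "Suc i < length p" "p ! i = u" "p ! Suc i = v"
    using assms(2) by (auto simp: just_before_def)
  obtain j k where jk: "j < k" "k < length p" "p ! j = w" "p ! k = v"
    using assms(3) by (auto simp: before_def)
  have "Suc i = k" using i jk assms(1) nth_eq_iff_index_eq[of p "Suc i" k] by auto
  then have "j < i" using i jk assms(4) by (metis less_SucE)
  then show ?thesis using i jk unfolding before_def by (intro exI[of _ j] exI[of _ i]) auto
qed

locale cycle_cofinal_graph = connected_locfin_graph +
  assumes cycles: "\<And>S. finite S \<Longrightarrow> S \<subseteq> verts G \<Longrightarrow> \<exists>p. is_cycle p \<and> S \<subseteq> set p"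
begin

text \<open>By local finiteness only finitely many vertices are reached by walks of a given length
  from a fixed vertex.\<close>

lemma countable_verts: "countable (verts G)"
proof -
  obtain v0 where v0: "v0 \<in> verts G" using infinite by (metis finite.emptyI ex_in_conv)
  have fin: "finite {v. (adj ^^ n) v0 v}" for n
  proof (induction n)
    case (Suc n)
    have "{v. (adj ^^ Suc n) v0 v} \<subseteq> (\<Union>u\<in>{v. (adj ^^ n) v0 v}. neighbours G u)" by auto
    then show ?case using Suc finite_neighbours by (metis (no_types, lifting) finite_UN_I finite_subset)
  qed simp
  have "verts G \<subseteq> (\<Union>n. {v. (adj ^^ n) v0 v})"
    using reachable[OF v0] by (auto simp: rtranclp_power)
  then show ?thesis using fin by (meson countable_UN countable_finite countable_subset countableI_type)
qed

lemma is_cycle_just_before: "is_cycle p \<Longrightarrow> just_before p u v \<Longrightarrow> adj u v"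
  unfolding is_cycle_def just_before_def successively_append_iff
  by (auto simp: successively_conv_nth)

end

text \<open>What a limit of the cycles retains: a linear order from \<open>v0\<close> to
  \<open>m\<close> with adjacent immediate neighbours, where the edge from \<open>m\<close> to
  \<open>v0\<close> closes the curve. The last assumption replaces the fact that a segment of a
  cycle is connected; in the limit an interval may be infinite, and only avoidance of finite sets
  survives.\<close>

locale limit_order_graph = cycle_cofinal_graph +
  fixes lt :: "'a \<Rightarrow> 'a \<Rightarrow> bool" and v0 m :: 'a
  assumes v0: "v0 \<in> verts G" and m_adj: "adj m v0"
    and lt_irrefl: "\<not> lt u u"
    and lt_trans: "lt u v \<Longrightarrow> lt v w \<Longrightarrow> lt u w"
    and lt_total: "u \<in> verts G \<Longrightarrow> v \<in> verts G \<Longrightarrow> u \<noteq> v \<Longrightarrow> lt u v \<or> lt v u"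
    and lt_min: "v \<in> verts G \<Longrightarrow> v \<noteq> v0 \<Longrightarrow> lt v0 v"
    and lt_max: "v \<in> verts G \<Longrightarrow> v \<noteq> m \<Longrightarrow> lt v m"
    and lt_succ: "v \<in> verts G \<Longrightarrow> v \<noteq> m \<Longrightarrow>
      \<exists>u. adj v u \<and> lt v u \<and> (\<forall>w\<in>verts G. lt v w \<longrightarrow> w = u \<or> lt u w)"
    and lt_pred: "v \<in> verts G \<Longrightarrow> v \<noteq> v0 \<Longrightarrow>
      \<exists>u. adj u v \<and> lt u v \<and> (\<forall>w\<in>verts G. lt w v \<longrightarrow> w = u \<or> lt w u)"
    and lt_interval: "finite S \<Longrightarrow> S \<subseteq> verts G \<Longrightarrow> lt a b \<Longrightarrow>
      (\<And>s. s \<in> S \<Longrightarrow> lt s a \<or> lt b s) \<Longrightarrow> (\<lambda>x y. adj x y \<and> x \<notin> S \<and> y \<notin> S)\<^sup>*\<^sup>* a b"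

text \<open>The orders of cycles that exhaust the vertices converge on a subsequence. Statements
  about finitely many vertices pass to the limit, and finite degrees keep immediate successors and
  predecessors from escaping.\<close>

theorem (in cycle_cofinal_graph) exists_limit_order:
  obtains lt :: "'a \<Rightarrow> 'a \<Rightarrow> bool" and v0 m where "limit_order_graph G lt v0 m"
proof -
  define e where "e = from_nat_into (verts G)"
  have e: "range e = verts G"
    using infinite countable_verts unfolding e_def by (metis range_from_nat_into finite.emptyI)
  define v0 where "v0 = e 0"
  have v0: "v0 \<in> verts G" using e by (auto simp: v0_def)
  have "\<exists>p. is_cycle p \<and> e ` {..n} \<subseteq> set p \<and> hd p = v0" for n
  proof -
    have "e ` {..n} \<subseteq> verts G" using e by blast
    then obtain p where p: "is_cycle p" "e ` {..n} \<subseteq> set p" using cycles[of "e ` {..n}"] by blast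
    then have "v0 \<in> set p" by (auto simp: v0_def)
    then obtain r where "is_cycle (v0 # r)" "set (v0 # r) = set p" by (rule cycle_from[OF p(1)])
    then show ?thesis using p by (intro exI[of _ "v0 # r"]) auto
  qed
  then obtain C where C: "\<And>n. is_cycle (C n)" "\<And>n. e ` {..n} \<subseteq> set (C n)" "\<And>n. hd (C n) = v0"
    by metis
  obtain k where k: "strict_mono (k :: nat \<Rightarrow> nat)"
    "\<And>x. x \<in> verts G \<times> verts G \<Longrightarrow>
      (\<forall>\<^sub>F n in sequentially. before (C (k n)) (fst x) (snd x)) \<or>
      (\<forall>\<^sub>F n in sequentially. \<not> before (C (k n)) (fst x) (snd x))"
    using eventually_const_subsequence[of "verts G \<times> verts G" "\<lambda>n x. before (C n) (fst x) (snd x)"]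
      countable_verts by auto
  define D where "D n = C (k n)" for n
  have cD: "is_cycle (D n)" and hD: "hd (D n) = v0" for n using C by (auto simp: D_def)
  have dD: "distinct (D n)" for n using cD is_cycle_distinct by blast
  have neD: "D n \<noteq> []" for n using cD[of n] by (auto simp: is_cycle_def)
  have inD: "\<forall>\<^sub>F n in sequentially. v \<in> set (D n)" if v: "v \<in> verts G" for v
  proof -
    obtain i where i: "v = e i" using v e by auto
    have "v \<in> set (D n)" if "n \<ge> i" for n
      using C(2)[of "k n"] seq_suble[OF k(1), of n] that i by (auto simp: D_def)
    then show ?thesis by (auto simp: eventually_sequentially)
  qed
  define lt where "lt u v \<longleftrightarrow> (\<forall>\<^sub>F n in sequentially. before (D n) u v)" for u v
  \<comment> \<open>On the subsequence each comparison is eventually constant, so it suffices to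
    verify it infinitely often.\<close>
  have ltI: "lt u v" if "u \<in> verts G" "v \<in> verts G" "\<exists>\<^sub>F n in sequentially. before (D n) u v" for u v
    using k(2)[of "(u, v)"] that by (auto simp: lt_def D_def frequently_def)
  have tot: "lt u v \<or> lt v u" if "u \<in> verts G" "v \<in> verts G" "u \<noteq> v" for u v
  proof (rule ccontr)
    assume no: "\<not> (lt u v \<or> lt v u)"
    then have "\<forall>\<^sub>F n in sequentially. \<not> before (D n) u v" "\<forall>\<^sub>F n in sequentially. \<not> before (D n) v u"
      using ltI that by (auto simp: frequently_def)
    then have "\<forall>\<^sub>F n in sequentially. False" using inD[OF that(1)] inD[OF that(2)]
    proof eventually_elim
      case (elim n)
      then show False using before_total[of u "D n" v] that(3) by blast
    qed
    then show False by simp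
  qed
  have min: "lt v0 v" if "v \<in> verts G" "v \<noteq> v0" for v
    using inD[OF that(1)] unfolding lt_def
    by eventually_elim (use before_hd[OF dD] hD that(2) in metis)
  \<comment> \<open>The last vertices of the cut cycles are neighbours of \<open>v0\<close>, hence
    one of these finitely many occurs infinitely often; it becomes \<open>m\<close>.\<close>
  have "\<exists>\<^sub>F n in sequentially. \<exists>y\<in>neighbours G v0. last (D n) = y"
  proof (rule eventually_frequently)
    have "adj (last (D n)) v0" for n
      using cD[of n] neD[of n] hD[of n] by (simp add: is_cycle_def successively_append_iff)
    then show "\<forall>\<^sub>F n in sequentially. \<exists>y\<in>neighbours G v0. last (D n) = y"
      using adj_sym by auto
  qed simp
  from frequently_bex_finite[OF finite_neighbours this]
  obtain m where m: "m \<in> neighbours G v0" "\<exists>\<^sub>F n in sequentially. last (D n) = m" by blast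
  then have mv0: "adj m v0" using adj_sym by simp
  have mV: "m \<in> verts G" using mv0 adj_verts by blast
  have max: "lt v m" if "v \<in> verts G" "v \<noteq> m" for v
  proof (rule ltI[OF that(1) mV])
    show "\<exists>\<^sub>F n in sequentially. before (D n) v m"
      using m(2)
    proof (rule frequently_rev_mp)
      show "\<forall>\<^sub>F n in sequentially. last (D n) = m \<longrightarrow> before (D n) v m"
        using inD[OF that(1)] by eventually_elim (use before_last that(2) in metis)
    qed
  qed
  have suc: "\<exists>u. adj v u \<and> lt v u \<and> (\<forall>w\<in>verts G. lt v w \<longrightarrow> w = u \<or> lt u w)"
    if v: "v \<in> verts G" "v \<noteq> m" for v
  proof -
    \<comment> \<open>The same pigeonhole argument among the neighbours of \<open>v\<close> yields
      its successor.\<close>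
    have "\<exists>\<^sub>F n in sequentially. \<exists>u\<in>neighbours G v. just_before (D n) v u"
    proof (rule eventually_frequently)
      show "\<forall>\<^sub>F n in sequentially. \<exists>u\<in>neighbours G v. just_before (D n) v u"
        using max[OF v] unfolding lt_def
      proof eventually_elim
        case (elim n)
        then obtain i where "Suc i < length (D n)" "D n ! i = v"
          unfolding before_def by (metis less_trans_Suc)
        then have "just_before (D n) v (D n ! Suc i)" by (auto simp: just_before_def)
        then show ?case using is_cycle_just_before[OF cD] by auto
      qed
    qed simp
    then obtain u where u: "adj v u" "\<exists>\<^sub>F n in sequentially. just_before (D n) v u"
      using frequently_bex_finite[OF finite_neighbours] by fastforce
    have uV: "u \<in> verts G" using u adj_verts by blast
    have "lt v u" by (rule ltI[OF v(1) uV frequently_elim1[OF u(2) just_before_before]])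
    moreover have "lt u w" if w: "w \<in> verts G" "lt v w" "w \<noteq> u" for w
    proof (rule ltI[OF uV w(1)])
      show "\<exists>\<^sub>F n in sequentially. before (D n) u w"
        using u(2)
      proof (rule frequently_rev_mp)
        show "\<forall>\<^sub>F n in sequentially. just_before (D n) v u \<longrightarrow> before (D n) u w"
          using w(2) unfolding lt_def by eventually_elim (use just_before_least[OF dD] w(3) in blast)
      qed
    qed
    ultimately show ?thesis using u by blast
  qed
  have pre: "\<exists>u. adj u v \<and> lt u v \<and> (\<forall>w\<in>verts G. lt w v \<longrightarrow> w = u \<or> lt w u)"
    if v: "v \<in> verts G" "v \<noteq> v0" for v
  proof -
    have "\<exists>\<^sub>F n in sequentially. \<exists>u\<in>neighbours G v. just_before (D n) u v"
    proof (rule eventually_frequently)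
      show "\<forall>\<^sub>F n in sequentially. \<exists>u\<in>neighbours G v. just_before (D n) u v"
        using min[OF v] unfolding lt_def
      proof eventually_elim
        case (elim n)
        then obtain i0 j where j: "i0 < j" "j < length (D n)" "D n ! j = v" by (auto simp: before_def)
        obtain i where "j = Suc i" using j(1) by (cases j) auto
        then have "Suc i < length (D n)" "D n ! Suc i = v" using j by auto
        then have "just_before (D n) (D n ! i) v" by (auto simp: just_before_def)
        then show ?case using is_cycle_just_before[OF cD] adj_sym in_neighbours by blast
      qed
    qed simp
    then obtain u where u: "adj v u" "\<exists>\<^sub>F n in sequentially. just_before (D n) u v"
      using frequently_bex_finite[OF finite_neighbours] by fastforce
    have uV: "u \<in> verts G" using u adj_verts by blast
    have "lt u v" by (rule ltI[OF uV v(1) frequently_elim1[OF u(2) just_before_before]])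
    moreover have "lt w u" if w: "w \<in> verts G" "lt w v" "w \<noteq> u" for w
    proof (rule ltI[OF w(1) uV])
      show "\<exists>\<^sub>F n in sequentially. before (D n) w u"
        using u(2)
      proof (rule frequently_rev_mp)
        show "\<forall>\<^sub>F n in sequentially. just_before (D n) u v \<longrightarrow> before (D n) w u"
          using w(2) unfolding lt_def by eventually_elim (use just_before_greatest[OF dD] w(3) in blast)
      qed
    qed
    ultimately show ?thesis using u adj_sym by blast
  qed
  have conn: "(\<lambda>x y. adj x y \<and> x \<notin> S \<and> y \<notin> S)\<^sup>*\<^sup>* a b"
    if S: "finite S" "S \<subseteq> verts G" and ab: "lt a b" and out: "\<And>s. s \<in> S \<Longrightarrow> lt s a \<or> lt b s" for S a b
  proof -
    have "\<forall>s\<in>S. \<forall>\<^sub>F n in sequentially. before (D n) s a \<or> before (D n) b s"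
    proof
      fix s assume "s \<in> S"
      then have "lt s a \<or> lt b s" by (rule out)
      then show "\<forall>\<^sub>F n in sequentially. before (D n) s a \<or> before (D n) b s"
        unfolding lt_def by (elim disjE) (auto elim!: eventually_mono)
    qed
    then have "\<forall>\<^sub>F n in sequentially. \<forall>s\<in>S. before (D n) s a \<or> before (D n) b s"
      using S(1) by (simp add: eventually_ball_finite)
    then have "\<forall>\<^sub>F n in sequentially. before (D n) a b \<and> (\<forall>s\<in>S. before (D n) s a \<or> before (D n) b s)"
      using ab unfolding lt_def by (simp add: eventually_conj_iff)
    \<comment> \<open>As \<open>S\<close> is finite, a single cycle \<open>D n\<close> places
      \<open>a\<close> before \<open>b\<close> and all of \<open>S\<close> outside the segment
      between them.\<close>
    then obtain n where n: "before (D n) a b" "\<And>s. s \<in> S \<Longrightarrow> before (D n) s a \<or> before (D n) b s"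
      using eventually_happens'[OF sequentially_bot] by blast
    then obtain i j where ij: "i < j" "j < length (D n)" "D n ! i = a" "D n ! j = b"
      by (auto simp: before_def)
    have out': "D n ! l \<notin> S" if "i \<le> l" "l \<le> j" for l
    proof
      assume "D n ! l \<in> S"
      then consider "before (D n) (D n ! l) (D n ! i)" | "before (D n) (D n ! j) (D n ! l)"
        using n(2) ij by blast
      then show False
        using dD[of n] that ij by cases (auto simp: before_def nth_eq_iff_index_eq)
    qed
    have adj': "adj (D n ! l) (D n ! Suc l)" if "l < j" for l
    proof (rule is_cycle_just_before[OF cD])
      show "just_before (D n) (D n ! l) (D n ! Suc l)"
        unfolding just_before_def using that ij by (intro exI[of _ l]) auto
    qed
    have "(\<lambda>x y. adj x y \<and> x \<notin> S \<and> y \<notin> S)\<^sup>*\<^sup>* (D n ! i) (D n ! l)" if "i \<le> l" "l \<le> j" for l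
      using that
    proof (induction l rule: dec_induct)
      case (step l)
      then show ?case
        using out'[of l] out'[of "Suc l"] adj'[of l] by (auto intro: rtranclp.rtrancl_into_rtrancl)
    qed simp
    then show ?thesis using ij by auto
  qed
  show thesis
  proof (rule that[of lt v0 m], unfold_locales)
    show "\<not> lt u u" for u
    proof
      assume "lt u u"
      then obtain n where "before (D n) u u"
        using eventually_happens'[OF sequentially_bot] unfolding lt_def by blast
      then show False using before_irrefl[OF dD] by blast
    qed
    show "lt u w" if "lt u v" "lt v w" for u v w
      using that unfolding lt_def by eventually_elim (use before_trans[OF dD] in blast)
  qed (fact v0 mv0 tot min max suc pre conn)+
qed

section \<open>Components and ends\<close>

context simple_ugraph begin

abbreviation adj_avoiding :: "'a set \<Rightarrow> 'a \<Rightarrow> 'a \<Rightarrow> bool" where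
  "adj_avoiding S \<equiv> \<lambda>a b. adj a b \<and> a \<notin> S \<and> b \<notin> S"

text \<open>For \<open>u \<in> S\<close> this is just \<open>{u}\<close>; it is a component of the
  graph without \<open>S\<close> when \<open>u\<close> is a vertex outside \<open>S\<close>.\<close>

definition component_of :: "'a set \<Rightarrow> 'a \<Rightarrow> 'a set" where
  "component_of S u = {v. (adj_avoiding S)\<^sup>*\<^sup>* u v}"

lemma component_of_refl: "u \<in> component_of S u" by (simp add: component_of_def)

lemma component_of_sym: "v \<in> component_of S u \<Longrightarrow> u \<in> component_of S v"
proof -
  assume "v \<in> component_of S u"
  moreover have "symp (adj_avoiding S)" by (auto intro!: sympI adj_sym)
  then have "symp ((adj_avoiding S)\<^sup>*\<^sup>*)" by (rule symp_rtranclp)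
  ultimately show ?thesis by (auto simp: component_of_def dest: sympD)
qed

lemma component_of_trans: "v \<in> component_of S u \<Longrightarrow> w \<in> component_of S v \<Longrightarrow> w \<in> component_of S u"
  by (auto simp: component_of_def)

lemma component_of_eq: "v \<in> component_of S u \<Longrightarrow> component_of S v = component_of S u"
  using component_of_sym component_of_trans by blast

lemma component_of_avoids:
  assumes "v \<in> component_of S u" "u \<in> verts G - S" shows "v \<in> verts G - S"
  using assms(1) unfolding component_of_def mem_Collect_eq
  by (induction rule: rtranclp_induct) (use assms(2) adj_verts in auto)

lemma graph_components_iff:
  "C \<in> graph_components (delete_verts G S) \<longleftrightarrow> (\<exists>u\<in>verts G - S. C = component_of S u)"
proof -
  have v: "verts (delete_verts G S) = verts G - S"
    by (auto simp: delete_verts_def induced_subgraph_def)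
  have "{v \<in> verts G - S. paths_between (delete_verts G S) u v \<noteq> {}} = component_of S u" if "u \<in> verts G - S" for u
    using that component_of_avoids[OF _ that] unfolding paths_between_delete_verts component_of_def by blast
  then show ?thesis unfolding graph_components_def v by blast
qed

lemma component_unique:
  assumes "C \<in> graph_components (delete_verts G S)" "C' \<in> graph_components (delete_verts G S)"
    "x \<in> C" "x \<in> C'"
  shows "C = C'"
  using assms component_of_eq unfolding graph_components_iff by blast

lemma component_eq_component_of:
  "C \<in> graph_components (delete_verts G S) \<Longrightarrow> x \<in> C \<Longrightarrow> C = component_of S x"
  using component_of_eq unfolding graph_components_iff by blast

lemma component_avoids:
  "C \<in> graph_components (delete_verts G S) \<Longrightarrow> x \<in> C \<Longrightarrow> x \<in> verts G \<and> x \<notin> S"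
  using component_of_avoids unfolding graph_components_iff by blast

lemma component_closed:
  assumes "C \<in> graph_components (delete_verts G S)" "u \<in> C" "adj u v"
  shows "v \<in> C \<or> v \<in> S"
proof (cases "v \<in> S")
  case False
  then have "v \<in> component_of S u"
    using component_avoids[OF assms(1,2)] assms(3) by (auto simp: component_of_def)
  then show ?thesis using component_eq_component_of[OF assms(1,2)] by blast
qed simp

lemma tail_in_unique:
  assumes "C \<in> graph_components (delete_verts G S)" "C' \<in> graph_components (delete_verts G S)"
    "tail_in r C" "tail_in r C'"
  shows "C = C'"
proof -
  obtain n n' where "\<forall>i\<ge>n. r i \<in> C" "\<forall>i\<ge>n'. r i \<in> C'" using assms by (auto simp: tail_in_def)
  then have "r (max n n') \<in> C" "r (max n n') \<in> C'" by auto
  then show ?thesis using component_unique assms by blast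
qed

text \<open>Being injective, a ray meets a finite set only finitely often; from then on consecutive
  vertices stay in one component.\<close>

lemma ray_tail:
  assumes "r \<in> rays G" "finite S"
  shows "\<exists>C\<in>graph_components (delete_verts G S). tail_in r C"
proof -
  have "finite (r -` S)" using assms by (auto simp: rays_def intro: finite_vimageI)
  then obtain n where n: "\<And>i. r i \<in> S \<Longrightarrow> i < n"
    by (auto simp: finite_nat_set_iff_bounded)
  have "r i \<in> component_of S (r n)" if "i \<ge> n" for i
    using that
  proof (induction i rule: dec_induct)
    case base then show ?case by (rule component_of_refl)
  next
    case (step i)
    have "adj (r i) (r (Suc i))" using assms by (auto simp: rays_def)
    moreover have "r i \<notin> S" "r (Suc i) \<notin> S" using n step by fastforce+
    ultimately have "r (Suc i) \<in> component_of S (r i)" by (auto simp: component_of_def)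
    then show ?case using step component_of_trans by blast
  qed
  moreover have "r n \<in> verts G - S" using n assms(1) by (auto simp: rays_def)
  ultimately show ?thesis
    by (intro bexI[of _ "component_of S (r n)"]) (auto simp: tail_in_def graph_components_iff)
qed

lemma ray_equivD:
  assumes "(r, r') \<in> ray_equiv G" "finite S" "S \<subseteq> verts G"
    "C \<in> graph_components (delete_verts G S)" "tail_in r C"
  shows "tail_in r' C"
proof -
  obtain C' where "C' \<in> graph_components (delete_verts G S)" "tail_in r C'" "tail_in r' C'"
    using assms unfolding ray_equiv_def by blast
  then show ?thesis using tail_in_unique[OF assms(4) _ assms(5)] by blast
qed

lemma end_of_ray:
  assumes "r \<in> rays G"
  shows "ray_equiv G `` {r} \<in> ends G"
    and "\<And>S C. finite S \<Longrightarrow> S \<subseteq> verts G \<Longrightarrow> C \<in> graph_components (delete_verts G S) \<Longrightarrow>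
      tail_in r C \<Longrightarrow> end_lives_in G S (ray_equiv G `` {r}) C"
proof -
  show *: "ray_equiv G `` {r} \<in> ends G" using assms by (auto simp: ends_def quotient_def)
  show "end_lives_in G S (ray_equiv G `` {r}) C" if "finite S" "S \<subseteq> verts G"
    "C \<in> graph_components (delete_verts G S)" "tail_in r C" for S C
    unfolding end_lives_in_def using * that ray_equivD by blast
qed

lemma end_component_unique:
  assumes "finite S" "end_lives_in G S \<omega> C" "end_lives_in G S \<omega> C'"
  shows "C = C'"
proof -
  obtain r where r: "r \<in> rays G" "\<omega> = ray_equiv G `` {r}"
    using assms(2) by (auto simp: end_lives_in_def ends_def quotient_def)
  have "(r, r) \<in> ray_equiv G" using r(1) ray_tail unfolding ray_equiv_def by blast
  then show ?thesis using assms tail_in_unique r(2) unfolding end_lives_in_def by blast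
qed

end

context connected_locfin_graph begin

text \<open>A geodesic ray from a base vertex that has infinitely many terms of \<open>a\<close> above each of
  its vertices lives in the same components as \<open>a\<close>.\<close>

lemma exists_ray:
  assumes a: "\<And>S. finite S \<Longrightarrow> S \<subseteq> verts G \<Longrightarrow> \<exists>C\<in>graph_components (delete_verts G S). tail_in a C"
  shows "\<exists>r\<in>rays G. \<forall>S C. finite S \<longrightarrow> S \<subseteq> verts G \<longrightarrow> C \<in> graph_components (delete_verts G S) \<longrightarrow>
    tail_in a C \<longrightarrow> tail_in r C"
proof -
  obtain v0 where v0: "v0 \<in> verts G" using infinite by (metis finite.emptyI ex_in_conv)
  define d where "d v = (LEAST n. (adj ^^ n) v0 v)" for v
  have d: "(adj ^^ d v) v0 v" if "v \<in> verts G" for v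
    using reachable[OF v0 that] unfolding d_def rtranclp_power by (rule LeastI_ex)
  have d_le: "d v \<le> n" if "(adj ^^ n) v0 v" for n v
    unfolding d_def using that by (rule Least_le)
  have d0: "d v0 = 0" using d_le[of 0 v0] by simp
  define R where "R u v \<longleftrightarrow> adj u v \<and> d v = Suc (d u)" for u v
  have Rpath: "R\<^sup>*\<^sup>* v0 v" if "v \<in> verts G" for v
    using that
  proof (induction "d v" arbitrary: v)
    case 0
    then show ?case using d[of v] by simp
  next
    case (Suc n)
    then have "(adj ^^ Suc n) v0 v" using d[of v] by simp
    then obtain u where u: "(adj ^^ n) v0 u" "adj u v" by (rule relpowp_Suc_E)
    have "(adj ^^ d u) v0 u" using d u adj_verts by blast
    then have "(adj ^^ Suc (d u)) v0 v" using u(2) by auto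
    then have "d u = n" using d_le[OF u(1)] d_le Suc(2) by fastforce
    then have "R u v" "R\<^sup>*\<^sup>* v0 u" using u Suc adj_verts by (auto simp: R_def)
    then show ?case by simp
  qed
  \<comment> \<open>\<open>R\<close> steps away from \<open>v0\<close> along shortest paths;
    \<open>P n u\<close> singles out the vertices at distance \<open>n\<close> that lie below
    infinitely many terms of \<open>a\<close>.\<close>
  define P where "P n u \<longleftrightarrow> u \<in> verts G \<and> d u = n \<and> infinite {i. R\<^sup>*\<^sup>* u (a i)}" for n u
  have cofin: "finite {i. \<not> (a i \<in> verts G - S)}" if S: "finite S" "S \<subseteq> verts G" for S
  proof -
    obtain C n where C: "C \<in> graph_components (delete_verts G S)" "\<forall>i\<ge>n. a i \<in> C"
      using a[OF S] by (auto simp: tail_in_def)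
    then have "{i. \<not> (a i \<in> verts G - S)} \<subseteq> {..<n}"
      using component_avoids[OF C(1)] by (auto simp: not_le[symmetric])
    then show ?thesis by (rule finite_subset) simp
  qed
  have P0: "P 0 v0"
  proof -
    have "finite (- {i. R\<^sup>*\<^sup>* v0 (a i)})"
      using cofin[of "{}"] Rpath by (auto intro: finite_subset[rotated])
    then have "infinite {i. R\<^sup>*\<^sup>* v0 (a i)}" by (metis finite_compl infinite_UNIV_nat)
    then show ?thesis using v0 d0 by (simp add: P_def)
  qed
  \<comment> \<open>Koenig's argument: \<open>u\<close> has finitely many neighbours and equals only
    finitely many terms of \<open>a\<close>, so some next vertex again lies below infinitely
    many.\<close>
  have Pstep: "\<exists>w. P (Suc n) w \<and> adj u w" if "P n u" for n u
  proof (rule ccontr)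
    assume no: "\<not> ?thesis"
    have "finite {i. R\<^sup>*\<^sup>* w (a i)}" if "w \<in> neighbours G u \<inter> {w. R u w}" for w
      using no that \<open>P n u\<close> adj_verts by (auto simp: P_def R_def)
    then have "finite (\<Union>w\<in>neighbours G u \<inter> {w. R u w}. {i. R\<^sup>*\<^sup>* w (a i)})"
      using finite_neighbours by (intro finite_UN_I) auto
    moreover have "finite {i. \<not> (a i \<in> verts G - {u})}" using cofin[of "{u}"] that by (auto simp: P_def)
    moreover have "{i. R\<^sup>*\<^sup>* u (a i)} \<subseteq> {i. \<not> (a i \<in> verts G - {u})} \<union>
      (\<Union>w\<in>neighbours G u \<inter> {w. R u w}. {i. R\<^sup>*\<^sup>* w (a i)})"
    proof
      fix i assume "i \<in> {i. R\<^sup>*\<^sup>* u (a i)}"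
      then have "R\<^sup>*\<^sup>* u (a i)" by simp
      then show "i \<in> {i. \<not> (a i \<in> verts G - {u})} \<union>
        (\<Union>w\<in>neighbours G u \<inter> {w. R u w}. {i. R\<^sup>*\<^sup>* w (a i)})"
        by (cases rule: converse_rtranclpE) (auto simp: R_def)
    qed
    ultimately have "finite {i. R\<^sup>*\<^sup>* u (a i)}" using finite_subset by blast
    then show False using that by (simp add: P_def)
  qed
  obtain r where r: "\<And>n. P n (r n) \<and> adj (r n) (r (Suc n))"
    using dependent_nat_choice[of P "\<lambda>n. adj"] P0 Pstep by metis
  have "inj r" using r by (intro injI) (metis P_def)
  then have "r \<in> rays G" using r by (auto simp: rays_def P_def)
  moreover have "tail_in r C" if S: "finite S" "S \<subseteq> verts G"
    and C: "C \<in> graph_components (delete_verts G S)" "tail_in a C" for S C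
  proof -
    \<comment> \<open>Vertices at distance at least \<open>K\<close> from \<open>v0\<close> avoid
      \<open>S\<close>, hence so does an ascending path from \<open>r n\<close> to a term of
      \<open>a\<close>.\<close>
    have "finite (d ` S)" using S by simp
    then obtain K where K: "\<And>s. s \<in> S \<Longrightarrow> d s < K" by (auto simp: finite_nat_set_iff_bounded)
    obtain i0 where i0: "\<And>i. i \<ge> i0 \<Longrightarrow> a i \<in> C" using C(2) by (auto simp: tail_in_def)
    have "r n \<in> C" if n: "n \<ge> K" for n
    proof -
      have inf: "infinite {i. R\<^sup>*\<^sup>* (r n) (a i)}" and dr: "d (r n) = n" using r by (auto simp: P_def)
      then obtain i where i: "i \<ge> i0" "R\<^sup>*\<^sup>* (r n) (a i)" by (auto simp: infinite_nat_iff_unbounded_le)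
      from i(2) have "a i \<in> component_of S (r n) \<and> d (a i) \<ge> K"
      proof (induction rule: rtranclp_induct)
        case base then show ?case using component_of_refl dr n by simp
      next
        case (step y z)
        then have "adj_avoiding S y z" using K by (fastforce simp: R_def)
        then have "z \<in> component_of S y" by (auto simp: component_of_def)
        then show ?case using step component_of_trans by (auto simp: R_def)
      qed
      then have "r n \<in> component_of S (a i)" using component_of_sym by blast
      then show ?thesis using component_eq_component_of[OF C(1) i0[OF i(1)]] by simp
    qed
    then show ?thesis by (auto simp: tail_in_def)
  qed
  ultimately show ?thesis by blast
qed

end

section \<open>The curve of a limit order\<close>

lemma edge_coords_0 [simp]: "edge_coords u v 0 = vertex_coords u"
  by (simp add: edge_coords_def)

lemma edge_coords_1 [simp]: "edge_coords u v 1 = vertex_coords v"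
  by (simp add: edge_coords_def)

lemma vertex_coords_inject [simp]: "vertex_coords u = vertex_coords v \<longleftrightarrow> u = v"
  by (metis indicator_eq_1_iff singletonD singletonI vertex_coords_def)

lemma edge_coords_support:
  assumes "u \<noteq> v" "0 < t" "t < 1"
  shows "edge_coords u v t w \<noteq> 0 \<longleftrightarrow> w = u \<or> w = v"
  using assms by (auto simp: edge_coords_def vertex_coords_def indicator_def)

lemma edge_coords_neq_vertex_coords:
  assumes "u \<noteq> v" "0 < t" "t < 1"
  shows "edge_coords u v t \<noteq> vertex_coords w"
proof
  assume eq: "edge_coords u v t = vertex_coords w"
  have "vertex_coords w u \<noteq> 0" "vertex_coords w v \<noteq> 0"
    using edge_coords_support[OF assms] eq by metis+
  then show False using assms(1) by (auto simp: vertex_coords_def indicator_def split: if_splits)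
qed

text \<open>The support of the coordinates of an inner point is the pair of end points, and the
  coordinates there give the parameter. So inner points determine their edge up to
  orientation.\<close>

lemma edge_coords_eqD:
  assumes "u \<noteq> v" "a \<noteq> b" "0 < t" "t < 1" "0 \<le> t'" "t' \<le> 1"
    and eq: "edge_coords u v t = edge_coords a b t'"
  shows "a = u \<and> b = v \<and> t' = t \<or> a = v \<and> b = u \<and> t' = 1 - t"
proof -
  have "t' \<noteq> 0" "t' \<noteq> 1"
    using eq edge_coords_neq_vertex_coords[OF assms(1,3,4), of a]
      edge_coords_neq_vertex_coords[OF assms(1,3,4), of b] by auto
  then have t': "0 < t'" "t' < 1" using assms by auto
  have "w = u \<or> w = v \<longleftrightarrow> w = a \<or> w = b" for w
    using edge_coords_support[OF assms(1,3,4)] edge_coords_support[OF assms(2) t'] eq by metis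
  then have "(a = u \<and> b = v) \<or> (a = v \<and> b = u)" using assms(1,2) by metis
  moreover have "edge_coords u v t v = t" "edge_coords u v t u = 1 - t"
    using assms(1) by (auto simp: edge_coords_def vertex_coords_def)
  moreover have "edge_coords a b t' b = t'"
    using assms(2) by (auto simp: edge_coords_def vertex_coords_def)
  ultimately show ?thesis using eq by metis
qed

context simple_ugraph begin

lemma open_one_complex: "open_in_complex G (one_complex G)"
proof -
  have "{t \<in> {0..1}. EdgePt u v t \<in> one_complex G} = {0..1}" if "adj u v" for u v
    using that by (auto simp: one_complex_def)
  then show ?thesis by (simp add: open_in_complex_def)
qed

text \<open>Reduces continuity into an end neighbourhood, at parameters mapped into the complex, to
  the topology of the complex. An edge that meets \<open>C\<close> stays in \<open>C\<close> or has
  its other end in \<open>S\<close>, which leaves few cases for its trace.\<close>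

lemma open_end_nbhd:
  assumes C: "C \<in> graph_components (delete_verts G S)" and "0 < \<epsilon>"
  shows "open_in_complex G (end_nbhd G S C \<epsilon> \<inter> range Pt)"
proof -
  let ?U = "end_nbhd G S C \<epsilon> \<inter> range Pt"
  let ?I = "induced_subgraph G C"
  have CV: "C \<subseteq> verts G" "C \<inter> S = {}" using component_avoids[OF C] by auto
  have vI: "verts ?I = C" using CV by (auto simp: induced_subgraph_def)
  have eI: "{u, v} \<in> edges ?I \<longleftrightarrow> adj u v \<and> u \<in> C \<and> v \<in> C" for u v
    by (auto simp: induced_subgraph_def)
  have mem: "Pt p \<in> ?U \<longleftrightarrow> (\<exists>v\<in>C. p = vertex_coords v) \<or>
    (\<exists>u v t. adj u v \<and> u \<in> C \<and> v \<in> C \<and> t \<in> {0..1} \<and> p = edge_coords u v t) \<or>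
    (\<exists>c s t. c \<in> C \<and> s \<in> S \<and> adj c s \<and> 0 < t \<and> t < 1 \<and> t < \<epsilon> \<and> p = edge_coords c s t)" for p
    by (simp add: end_nbhd_def one_complex_def vI eI image_iff) blast
  have vert: "Vertex w \<in> ?U \<longleftrightarrow> w \<in> C" for w
  proof
    assume "Vertex w \<in> ?U"
    then consider v where "v \<in> C" "vertex_coords w = vertex_coords v"
      | u v t where "adj u v" "u \<in> C" "v \<in> C" "t \<in> {0..1}" "vertex_coords w = edge_coords u v t"
      | c s t where "adj c s" "0 < t" "t < 1" "vertex_coords w = edge_coords c s t"
      unfolding mem by blast
    then show "w \<in> C"
    proof cases
      case 1 then show ?thesis by simp
    next
      case 2
      then have "\<not> (0 < t \<and> t < 1)"
        using edge_coords_neq_vertex_coords[of u v t w] adj_verts[of u v] by metis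
      then have "t = 0 \<or> t = 1" using 2 by auto
      then show ?thesis using 2 by auto
    next
      case 3
      then show ?thesis using edge_coords_neq_vertex_coords[of c s t w] adj_verts[of c s] by metis
    qed
  next
    assume "w \<in> C"
    then show "Vertex w \<in> ?U" unfolding mem by blast
  qed
  have inner: "EdgePt u v t \<in> ?U \<longleftrightarrow> u \<in> C \<and> v \<in> C \<or> u \<in> C \<and> v \<in> S \<and> t < \<epsilon> \<or> v \<in> C \<and> u \<in> S \<and> 1 - t < \<epsilon>"
    (is "?L \<longleftrightarrow> ?R") if uv: "adj u v" and t: "0 < t" "t < 1" for u v t
  proof
    have ne: "u \<noteq> v" using adj_verts[OF uv] by blast
    assume ?L
    then consider w where "edge_coords u v t = vertex_coords w"
      | a b t' where "adj a b" "a \<in> C" "b \<in> C" "t' \<in> {0..1}" "edge_coords u v t = edge_coords a b t'"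
      | c s t' where "c \<in> C" "s \<in> S" "adj c s" "0 < t'" "t' < 1" "t' < \<epsilon>" "edge_coords u v t = edge_coords c s t'"
      unfolding mem by blast
    then show ?R
    proof cases
      case 1 then show ?thesis using edge_coords_neq_vertex_coords[OF ne t] by blast
    next
      case 2
      then show ?thesis using edge_coords_eqD[OF ne _ t, of a b t'] adj_verts[of a b] by auto
    next
      case 3
      then show ?thesis using edge_coords_eqD[OF ne _ t, of c s t'] adj_verts[of c s] by auto
    qed
  next
    assume ?R
    moreover have "EdgePt u v t = EdgePt v u (1 - t)" by (simp add: edge_coords_def add.commute)
    moreover have "adj v u" using adj_sym[OF uv] .
    moreover have "t \<in> {0..1}" "0 < 1 - t" "1 - t < 1" using t by auto
    ultimately show ?L unfolding mem using uv t by (metis fpoint.inject(1))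
  qed
  have "openin (top_of_set {0..1}) {t \<in> {0..1}. EdgePt u v t \<in> ?U}" if uv: "adj u v" for u v
  proof -
    let ?A = "{t \<in> {0..1}. EdgePt u v t \<in> ?U}"
    have A: "t \<in> ?A \<longleftrightarrow> t = 0 \<and> u \<in> C \<or> t = 1 \<and> v \<in> C \<or> 0 < t \<and> t < 1 \<and>
      (u \<in> C \<and> v \<in> C \<or> u \<in> C \<and> v \<in> S \<and> t < \<epsilon> \<or> v \<in> C \<and> u \<in> S \<and> 1 - t < \<epsilon>)" for t
    proof -
      consider "t = 0" | "t = 1" | "0 < t" "t < 1" | "t \<notin> {0..1}" by fastforce
      then show ?thesis
      proof cases
        case 3 then show ?thesis using inner[OF uv 3] by auto
      qed (use vert[of u] vert[of v] in auto)
    qed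
    have closed: "u \<in> C \<Longrightarrow> v \<in> C \<or> v \<in> S" "v \<in> C \<Longrightarrow> u \<in> C \<or> u \<in> S"
      using component_closed[OF C] uv adj_sym by blast+
    consider "u \<in> C" "v \<in> C" | "u \<in> C" "v \<in> S" "v \<notin> C" "u \<notin> S"
      | "v \<in> C" "u \<in> S" "u \<notin> C" "v \<notin> S" | "u \<notin> C" "v \<notin> C"
      using closed CV by blast
    then have "\<exists>O'. open O' \<and> ?A = {0..1} \<inter> O'"
    proof cases
      case 1
      have "?A = {0..1} \<inter> UNIV" unfolding set_eq_iff A using 1 by auto
      then show ?thesis by blast
    next
      case 2
      have "?A = {0..1} \<inter> ({..<1} \<inter> {..<\<epsilon>})" unfolding set_eq_iff A using 2 \<open>0 < \<epsilon>\<close> by auto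
      then show ?thesis using open_Int[OF open_lessThan[of 1] open_lessThan[of \<epsilon>]] by blast
    next
      case 3
      have "?A = {0..1} \<inter> ({0<..} \<inter> {1 - \<epsilon><..})" unfolding set_eq_iff A using 3 \<open>0 < \<epsilon>\<close> by auto
      then show ?thesis using open_Int[OF open_greaterThan[of 0] open_greaterThan[of "1 - \<epsilon>"]] by blast
    next
      case 4
      have "?A = {0..1} \<inter> {}" unfolding set_eq_iff A using 4 by auto
      then show ?thesis by blast
    qed
    then show ?thesis unfolding openin_open by blast
  qed
  moreover have "?U \<subseteq> one_complex G"
  proof
    fix x assume "x \<in> ?U"
    then obtain p where p: "x = Pt p" "Pt p \<in> ?U" by blast
    then consider v where "v \<in> C" "p = vertex_coords v"
      | u v t where "adj u v" "t \<in> {0..1}" "p = edge_coords u v t"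
      | c s t where "adj c s" "0 < t" "t < 1" "p = edge_coords c s t"
      unfolding mem by blast
    then show "x \<in> one_complex G"
    proof cases
      case 1 then show ?thesis using CV p(1) by (auto simp: one_complex_def)
    next
      case 2 then show ?thesis unfolding p(1) one_complex_def by blast
    next
      case 3
      then have "t \<in> {0..1}" by simp
      with 3 show ?thesis unfolding p(1) one_complex_def by blast
    qed
  qed
  ultimately show ?thesis by (simp add: open_in_complex_def)
qed

end

context limit_order_graph begin

section \<open>Successors and positions on the parameter interval\<close>

abbreviation "V \<equiv> verts G"

lemma m: "m \<in> V" using m_adj adj_verts by blast

definition succ :: "'a \<Rightarrow> 'a" where
  "succ v = (if v = m then v0
    else SOME u. adj v u \<and> lt v u \<and> (\<forall>w\<in>V. lt v w \<longrightarrow> w = u \<or> lt u w))"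

lemma succ_m [simp]: "succ m = v0" by (simp add: succ_def)

lemma succ_props:
  assumes "v \<in> V" "v \<noteq> m"
  shows "adj v (succ v)" "lt v (succ v)" "\<And>w. w \<in> V \<Longrightarrow> lt v w \<Longrightarrow> w = succ v \<or> lt (succ v) w"
  using someI_ex[OF lt_succ[OF assms]] assms by (auto simp: succ_def)

lemma adj_succ: "v \<in> V \<Longrightarrow> adj v (succ v)"
  using succ_props m_adj by (cases "v = m") auto

lemma succ_in: "v \<in> V \<Longrightarrow> succ v \<in> V" using adj_succ adj_verts by blast

lemma ex_pred:
  assumes "v \<in> V" "v \<noteq> v0"
  shows "\<exists>u\<in>V. u \<noteq> m \<and> succ u = v"
proof -
  obtain u where u: "adj u v" "lt u v" "\<And>w. w \<in> V \<Longrightarrow> lt w v \<Longrightarrow> w = u \<or> lt w u"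
    using lt_pred[OF assms] by blast
  have uV: "u \<in> V" using u adj_verts by blast
  \<comment> \<open>As \<open>m\<close> is the maximum, the predecessor \<open>u\<close> differs
    from \<open>m\<close>, where \<open>succ\<close> wraps around to \<open>v0\<close>.\<close>
  have um: "u \<noteq> m" using u(2) lt_max[OF assms(1)] lt_trans lt_irrefl by metis
  have "v = succ u \<or> lt (succ u) v" using succ_props(3)[OF uV um assms(1)] u by blast
  moreover have "\<not> lt (succ u) v"
    using u(3)[OF succ_in[OF uV]] succ_props(2)[OF uV um] lt_trans lt_irrefl by metis
  ultimately show ?thesis using uV um by blast
qed

text \<open>The curve traverses the edge from \<open>v\<close> to \<open>succ v\<close> on \<open>[pos v, pos v + wt v]\<close>; the remaining
  parameters, the gaps, are mapped to ends.\<close>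

definition wt :: "'a \<Rightarrow> real" where
  "wt v = (1/2) ^ to_nat_on V v"

definition pos :: "'a \<Rightarrow> real" where
  "pos v = infsum wt {u \<in> V. lt u v}"

definition total_wt :: real where
  "total_wt = infsum wt V"

lemma wt_pos: "wt v > 0" by (simp add: wt_def)

lemma summable_wt: "A \<subseteq> V \<Longrightarrow> wt summable_on A"
proof -
  assume A: "A \<subseteq> V"
  have "(\<lambda>n. (1/2 :: real) ^ n) summable_on UNIV"
    by (rule norm_summable_imp_summable_on) simp
  then have "(\<lambda>n. (1/2 :: real) ^ n) summable_on (to_nat_on V ` A)"
    using summable_on_subset_banach by blast
  moreover have "inj_on (to_nat_on V) A"
    using inj_on_to_nat_on[OF countable_verts] A inj_on_subset by blast
  moreover have "wt = (\<lambda>n. (1/2) ^ n) \<circ> to_nat_on V" by (auto simp: wt_def)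
  ultimately show ?thesis using summable_on_reindex by metis
qed

lemma infsum_insert_below: "v \<in> V \<Longrightarrow> infsum wt (insert v {u \<in> V. lt u v}) = pos v + wt v"
  unfolding pos_def by (subst infsum_insert) (auto intro: summable_wt simp: lt_irrefl)

lemma pos_nonneg: "pos v \<ge> 0"
  unfolding pos_def by (rule infsum_nonneg) (simp add: less_imp_le[OF wt_pos])

lemma infsum_wt_mono: "A \<subseteq> B \<Longrightarrow> B \<subseteq> V \<Longrightarrow> infsum wt A \<le> infsum wt B"
  by (rule infsum_mono2) (auto intro!: summable_wt less_imp_le[OF wt_pos])

lemma pos_mono:
  assumes "u \<in> V" "v \<in> V" "lt u v" shows "pos u + wt u \<le> pos v"
  unfolding infsum_insert_below[OF assms(1), symmetric] pos_def[of v]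
  by (rule infsum_wt_mono) (use assms lt_trans in blast)+

lemma pos_le_total: "v \<in> V \<Longrightarrow> pos v + wt v \<le> total_wt"
  unfolding infsum_insert_below[symmetric] total_wt_def by (rule infsum_wt_mono) auto

lemma pos_lt_iff: "u \<in> V \<Longrightarrow> v \<in> V \<Longrightarrow> lt u v \<longleftrightarrow> pos u < pos v"
  using pos_mono[of u v] pos_mono[of v u] wt_pos[of u] wt_pos[of v] lt_total[of u v] lt_irrefl by force

lemma pos_le_imp: "u \<in> V \<Longrightarrow> v \<in> V \<Longrightarrow> pos u < pos v \<Longrightarrow> pos u + wt u \<le> pos v"
  using pos_mono pos_lt_iff by blast

lemma pos_v0 [simp]: "pos v0 = 0"
proof -
  have eq: "{u \<in> V. lt u v0} = {}" using lt_min lt_trans lt_irrefl by blast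
  show ?thesis unfolding pos_def eq by simp
qed

lemma pos_succ:
  assumes "v \<in> V" "v \<noteq> m" shows "pos (succ v) = pos v + wt v"
proof -
  have "{u \<in> V. lt u (succ v)} = insert v {u \<in> V. lt u v}"
    using assms(1) succ_props[OF assms] lt_trans lt_irrefl lt_total by blast
  then show ?thesis using infsum_insert_below[OF assms(1)] by (simp add: pos_def)
qed

lemma pos_m: "pos m + wt m = total_wt"
proof -
  have "V = insert m {u \<in> V. lt u m}" using m lt_max by blast
  then show ?thesis unfolding total_wt_def using infsum_insert_below[OF m] by simp
qed

lemma total_pos: "total_wt > 0" using pos_m wt_pos[of m] pos_nonneg[of m] by linarith

section \<open>Gaps and their ends\<close>

definition gap :: "real \<Rightarrow> bool" where
  "gap s \<longleftrightarrow> 0 \<le> s \<and> s < total_wt \<and> (\<forall>v\<in>V. \<not> (pos v \<le> s \<and> s < pos v + wt v))"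

lemma gap_cases:
  assumes s: "0 \<le> s" "s < total_wt"
  obtains "gap s" | v where "v \<in> V" "pos v \<le> s" "s < pos v + wt v"
  using assms unfolding gap_def by blast

text \<open>The interval of \<open>succ v\<close> starts where that of \<open>v\<close> stops, so a
  gap cannot lie at this common point.\<close>

lemma gap_below:
  assumes "gap s" "v \<in> V" "pos v \<le> s" shows "v \<noteq> m" "pos (succ v) < s"
proof -
  have le: "pos v + wt v \<le> s" using assms by (auto simp: gap_def)
  then show vm: "v \<noteq> m" using assms pos_m by (auto simp: gap_def)
  show "pos (succ v) < s"
  proof (rule ccontr)
    assume "\<not> pos (succ v) < s"
    then have "pos (succ v) = s" using le pos_succ[OF assms(2) vm] by simp
    then show False using assms(1) succ_in[OF assms(2)] wt_pos[of "succ v"] by (auto simp: gap_def)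
  qed
qed

lemma gap_above:
  assumes "gap s" "v \<in> V" "s < pos v" shows "\<exists>u\<in>V. s < pos u \<and> pos u < pos v \<and> succ u = v"
proof -
  have "v \<noteq> v0" using assms by (auto simp: gap_def)
  then obtain u where u: "u \<in> V" "u \<noteq> m" "succ u = v" using ex_pred assms(2) by blast
  then have p: "pos v = pos u + wt u" using pos_succ by blast
  have "s < pos u"
  proof (rule ccontr)
    assume "\<not> s < pos u"
    then show False using assms u p by (auto simp: gap_def)
  qed
  then show ?thesis using u p wt_pos[of u] by auto
qed

lemma gap_v0: "gap s \<Longrightarrow> pos v0 < s"
  using wt_pos[of v0] v0 by (force simp: gap_def)

lemma gap_m: "gap s \<Longrightarrow> s < pos m"
  using gap_below(1)[of s m] m by force

text \<open>Take the vertices \<open>x\<close> and \<open>y\<close> of \<open>S\<close> closest to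
  the gap on either side, with \<open>v0\<close> and \<open>m\<close> as defaults. One step inwards
  from each gives \<open>l\<close> and \<open>r\<close>, and the vertices from \<open>l\<close> to
  \<open>r\<close> form an interval avoiding \<open>S\<close>.\<close>

lemma gap_separation:
  assumes s: "gap s" and S: "finite S" "S \<subseteq> V"
  obtains l r where "l \<in> V" "r \<in> V" "pos l < s" "s < pos r"
    "\<And>v. v \<in> V \<Longrightarrow> pos l \<le> pos v \<Longrightarrow> pos v \<le> pos r \<Longrightarrow> v \<in> component_of S l" "l \<notin> S"
proof -
  define L where "L = insert v0 {v \<in> S. pos v < s}"
  define R where "R = insert m {v \<in> S. s < pos v}"
  have fin: "finite (pos ` L)" "finite (pos ` R)" using S by (auto simp: L_def R_def)
  have LV: "L \<subseteq> V" "R \<subseteq> V" using S v0 m by (auto simp: L_def R_def)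
  have "Max (pos ` L) \<in> pos ` L" using fin by (intro Max_in) (auto simp: L_def)
  then obtain x where x: "x \<in> L" "pos x = Max (pos ` L)" by auto
  have "Min (pos ` R) \<in> pos ` R" using fin by (intro Min_in) (auto simp: R_def)
  then obtain y where y: "y \<in> R" "pos y = Min (pos ` R)" by auto
  have xl: "pos v \<le> pos x" if "v \<in> L" for v using Max_ge[OF fin(1), of "pos v"] that x by simp
  have yr: "pos y \<le> pos v" if "v \<in> R" for v using Min_le[OF fin(2), of "pos v"] that y by simp
  have xs: "pos x \<le> s" "s < pos y" using x(1) y(1) gap_v0[OF s] gap_m[OF s] by (auto simp: L_def R_def)
  have xV: "x \<in> V" "y \<in> V" using x y LV by auto
  define l where "l = succ x"
  have l: "l \<in> V" "pos l < s" "pos x < pos l"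
    using gap_below[OF s xV(1) xs(1)] succ_in xV pos_succ[of x] wt_pos[of x] by (auto simp: l_def)
  obtain r where r: "r \<in> V" "s < pos r" "pos r < pos y" using gap_above[OF s xV(2) xs(2)] by blast
  have sep: "pos z < pos l \<or> pos r < pos z" if "z \<in> S" for z
  proof -
    have "pos z < s \<or> s < pos z" using gap_below(2)[OF s, of z] pos_succ[of z] gap_below(1)[OF s, of z]
        wt_pos[of z] S that by fastforce
    then show ?thesis using xl[of z] yr[of z] that l r by (fastforce simp: L_def R_def)
  qed
  have *: "v \<in> component_of S l" if v: "v \<in> V" "pos l \<le> pos v" "pos v \<le> pos r" for v
  proof (cases "v = l")
    case True then show ?thesis by (simp add: component_of_refl)
  next
    case False
    then have "lt l v" using lt_total[of l v] pos_lt_iff[of v l] v l by auto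
    moreover have "lt z l \<or> lt v z" if "z \<in> S" for z
      using sep[OF that] v l pos_lt_iff S that by force
    ultimately show ?thesis using lt_interval[OF S] by (simp add: component_of_def)
  qed
  moreover have "l \<notin> S" using sep[of l] l r by force
  ultimately show thesis using that[of l r] l r by blast
qed

text \<open>The vertices \<open>a n\<close> approach the gap from below and thus end up in the
  component given by \<open>gap_separation\<close>, for every \<open>S\<close>. The ray obtained
  from this sequence determines one end that serves all \<open>S\<close> simultaneously.\<close>

lemma gap_end:
  assumes s: "gap s"
  shows "\<exists>\<omega>. \<forall>S. finite S \<longrightarrow> S \<subseteq> V \<longrightarrow> (\<exists>l r C. l \<in> V \<and> r \<in> V \<and> pos l < s \<and> s < pos r \<and>
    end_lives_in G S \<omega> C \<and> (\<forall>v\<in>V. pos l \<le> pos v \<longrightarrow> pos v \<le> pos r \<longrightarrow> v \<in> C))"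
proof -
  \<comment> \<open>\<open>a n\<close> will be the topmost among these finitely many vertices below
    the gap; \<open>v0\<close> is included to keep the set nonempty.\<close>
  define F where "F n = insert v0 {v \<in> V. pos v < s \<and> to_nat_on V v \<le> n}" for n
  have finF: "finite (F n)" for n
  proof -
    have "inj_on (to_nat_on V) {v \<in> V. pos v < s \<and> to_nat_on V v \<le> n}"
      by (rule inj_on_subset[OF inj_on_to_nat_on[OF countable_verts]]) auto
    then have "finite {v \<in> V. pos v < s \<and> to_nat_on V v \<le> n}"
      by (rule inj_on_finite[of _ _ "{..n}"]) auto
    then show ?thesis by (simp add: F_def)
  qed
  have "\<exists>x\<in>F n. \<forall>y\<in>F n. pos y \<le> pos x" for n
  proof -
    have "Max (pos ` F n) \<in> pos ` F n" using finF by (intro Max_in) (auto simp: F_def)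
    then obtain x where x: "x \<in> F n" "pos x = Max (pos ` F n)" by auto
    then show ?thesis using finF by (intro bexI[of _ x]) auto
  qed
  then obtain a where a: "\<And>n. a n \<in> F n" "\<And>n y. y \<in> F n \<Longrightarrow> pos y \<le> pos (a n)" by metis
  have aV: "a n \<in> V" "pos (a n) < s" for n
  proof -
    have "a n = v0 \<or> a n \<in> V \<and> pos (a n) < s" using a(1)[of n] by (auto simp: F_def)
    then show "a n \<in> V" "pos (a n) < s" using v0 gap_v0[OF s] by (elim disjE; simp)+
  qed
  have tail: "tail_in a (component_of S l)" if "l \<in> V" "pos l < s" "s < pos r"
    "\<And>v. v \<in> V \<Longrightarrow> pos l \<le> pos v \<Longrightarrow> pos v \<le> pos r \<Longrightarrow> v \<in> component_of S l" for S l r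
  proof -
    have "a n \<in> component_of S l" if "n \<ge> to_nat_on V l" for n
    proof -
      have "l \<in> F n" using that \<open>l \<in> V\<close> \<open>pos l < s\<close> by (simp add: F_def)
      then show ?thesis using a(2) aV[of n] that \<open>s < pos r\<close>
        by (intro \<open>\<And>v. v \<in> V \<Longrightarrow> pos l \<le> pos v \<Longrightarrow> pos v \<le> pos r \<Longrightarrow> v \<in> component_of S l\<close>) auto
    qed
    then show ?thesis by (auto simp: tail_in_def)
  qed
  have ex: "\<exists>l r C. l \<in> V \<and> r \<in> V \<and> pos l < s \<and> s < pos r \<and> C \<in> graph_components (delete_verts G S) \<and>
    tail_in a C \<and> (\<forall>v\<in>V. pos l \<le> pos v \<longrightarrow> pos v \<le> pos r \<longrightarrow> v \<in> C)" if S: "finite S" "S \<subseteq> V" for S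
  proof -
    obtain l r where lr: "l \<in> V" "r \<in> V" "pos l < s" "s < pos r"
      "\<And>v. v \<in> V \<Longrightarrow> pos l \<le> pos v \<Longrightarrow> pos v \<le> pos r \<Longrightarrow> v \<in> component_of S l" "l \<notin> S"
      using gap_separation[OF s S] by blast
    have "component_of S l \<in> graph_components (delete_verts G S)"
      using lr by (auto simp: graph_components_iff)
    then show ?thesis using lr tail[OF lr(1,3,4,5)] by blast
  qed
  then have "\<exists>C\<in>graph_components (delete_verts G S). tail_in a C" if "finite S" "S \<subseteq> V" for S
    using that by blast
  from exists_ray[of a, OF this] obtain r where r: "r \<in> rays G"
    "\<And>S C. finite S \<Longrightarrow> S \<subseteq> V \<Longrightarrow> C \<in> graph_components (delete_verts G S) \<Longrightarrow>
      tail_in a C \<Longrightarrow> tail_in r C" by blast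
  show ?thesis
  proof (intro exI[of _ "ray_equiv G `` {r}"] allI impI)
    fix S assume S: "finite S" "S \<subseteq> V"
    obtain l r' C where C: "l \<in> V" "r' \<in> V" "pos l < s" "s < pos r'"
      "C \<in> graph_components (delete_verts G S)" "tail_in a C"
      "\<forall>v\<in>V. pos l \<le> pos v \<longrightarrow> pos v \<le> pos r' \<longrightarrow> v \<in> C" using ex[OF S] by blast
    have "end_lives_in G S (ray_equiv G `` {r}) C"
      using end_of_ray(2)[OF r(1) S C(5)] r(2)[OF S C(5,6)] by blast
    then show "\<exists>l r' C. l \<in> V \<and> r' \<in> V \<and> pos l < s \<and> s < pos r' \<and>
      end_lives_in G S (ray_equiv G `` {r}) C \<and> (\<forall>v\<in>V. pos l \<le> pos v \<longrightarrow> pos v \<le> pos r' \<longrightarrow> v \<in> C)"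
      using C by blast
  qed
qed

definition gap_end_of :: "real \<Rightarrow> (nat \<Rightarrow> 'a) set" where
  "gap_end_of s = (SOME \<omega>. \<forall>S. finite S \<longrightarrow> S \<subseteq> V \<longrightarrow> (\<exists>l r C. l \<in> V \<and> r \<in> V \<and> pos l < s \<and> s < pos r \<and>
    end_lives_in G S \<omega> C \<and> (\<forall>v\<in>V. pos l \<le> pos v \<longrightarrow> pos v \<le> pos r \<longrightarrow> v \<in> C)))"

lemma gap_end_of:
  assumes "gap s" "finite S" "S \<subseteq> V"
  obtains l r C where "l \<in> V" "r \<in> V" "pos l < s" "s < pos r" "end_lives_in G S (gap_end_of s) C"
    "\<And>v. v \<in> V \<Longrightarrow> pos l \<le> pos v \<Longrightarrow> pos v \<le> pos r \<Longrightarrow> v \<in> C"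
proof -
  have "\<exists>l r C. l \<in> V \<and> r \<in> V \<and> pos l < s \<and> s < pos r \<and> end_lives_in G S (gap_end_of s) C \<and>
    (\<forall>v\<in>V. pos l \<le> pos v \<longrightarrow> pos v \<le> pos r \<longrightarrow> v \<in> C)"
    using someI_ex[OF gap_end[OF assms(1)], rule_format, OF assms(2,3)] unfolding gap_end_of_def .
  then show thesis using that by blast
qed

section \<open>The curve and its continuity\<close>

definition curve :: "real \<Rightarrow> 'a fpoint" where
  "curve s = (if s = total_wt then Vertex v0 else if gap s then End (gap_end_of s)
    else let v = SOME v. v \<in> V \<and> pos v \<le> s \<and> s < pos v + wt v in EdgePt v (succ v) ((s - pos v) / wt v))"

lemma curve_edge_lt:
  assumes "v \<in> V" "pos v \<le> s" "s < pos v + wt v"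
  shows "curve s = EdgePt v (succ v) ((s - pos v) / wt v)"
proof -
  have uniq: "u = v" if u: "u \<in> V \<and> pos u \<le> s \<and> s < pos u + wt u" for u
  proof (rule ccontr)
    assume "u \<noteq> v"
    then have "lt u v \<or> lt v u" using lt_total u assms by blast
    then show False using pos_mono[of u v] pos_mono[of v u] u assms by auto
  qed
  have "(SOME u. u \<in> V \<and> pos u \<le> s \<and> s < pos u + wt u) = v"
  proof (rule some_equality)
    show "v \<in> V \<and> pos v \<le> s \<and> s < pos v + wt v" using assms by simp
  qed (fact uniq)
  moreover have "s \<noteq> total_wt" "\<not> gap s" using assms pos_le_total[of v] by (auto simp: gap_def)
  ultimately show ?thesis by (simp add: curve_def)
qed

text \<open>The formula persists at the right end point, where the next edge begins or, after
  \<open>m\<close>, the curve returns to \<open>v0\<close>.\<close>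

lemma curve_edge:
  assumes "v \<in> V" "pos v \<le> s" "s \<le> pos v + wt v"
  shows "curve s = EdgePt v (succ v) ((s - pos v) / wt v)"
proof (cases "s < pos v + wt v")
  case True then show ?thesis using curve_edge_lt assms by blast
next
  case False
  then have s: "s = pos v + wt v" using assms by simp
  then have "(s - pos v) / wt v = 1" using wt_pos[of v] by simp
  moreover have "curve s = Vertex (succ v)"
  proof (cases "v = m")
    case True then show ?thesis using s pos_m by (simp add: curve_def)
  next
    case False
    then have "s = pos (succ v)" using s pos_succ assms by simp
    then show ?thesis using curve_edge_lt[of "succ v" s] wt_pos[of "succ v"] succ_in[OF assms(1)] by simp
  qed
  ultimately show ?thesis by simp
qed

lemma curve_gap: "gap s \<Longrightarrow> curve s = End (gap_end_of s)"
  by (auto simp: curve_def gap_def)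

lemma curve_total: "curve total_wt = Vertex v0" by (simp add: curve_def)

lemma curve_vertex_iff:
  assumes s: "0 \<le> s" "s < total_wt" and v: "v \<in> V"
  shows "curve s = Vertex v \<longleftrightarrow> s = pos v"
proof
  assume "s = pos v"
  then show "curve s = Vertex v" using curve_edge[OF v, of s] wt_pos[of v] by simp
next
  assume c: "curve s = Vertex v"
  show "s = pos v"
  proof (cases rule: gap_cases[OF s])
    case 1 then show ?thesis using c by (simp add: curve_gap)
  next
    case (2 u)
    define t where "t = (s - pos u) / wt u"
    have t: "0 \<le> t" "t < 1" using 2 wt_pos[of u] by (auto simp: t_def divide_simps)
    have eq: "edge_coords u (succ u) t = vertex_coords v"
      using c curve_edge_lt[OF 2] by (simp add: t_def)
    have "u \<noteq> succ u" using adj_succ[OF 2(1)] adj_verts by blast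
    then have "t = 0" using edge_coords_neq_vertex_coords[of u "succ u" t v] eq t by force
    then show ?thesis using eq wt_pos[of u] by (auto simp: t_def)
  qed
qed

lemma edge_point_in_complex: "v \<in> V \<Longrightarrow> 0 \<le> t \<Longrightarrow> t \<le> 1 \<Longrightarrow> EdgePt v (succ v) t \<in> one_complex G"
  using adj_succ unfolding one_complex_def by fastforce

lemma curve_open_edge:
  assumes U: "open_in_complex G U" and v: "v \<in> V" and s: "pos v \<le> s" "s \<le> pos v + wt v" and c: "curve s \<in> U"
  shows "\<exists>e>0. \<forall>s'. pos v \<le> s' \<longrightarrow> s' \<le> pos v + wt v \<longrightarrow> \<bar>s' - s\<bar> < e \<longrightarrow> curve s' \<in> U"
proof -
  define \<tau> where "\<tau> s = (s - pos v) / wt v" for s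
  have \<tau>: "0 \<le> \<tau> s \<and> \<tau> s \<le> 1" if "pos v \<le> s" "s \<le> pos v + wt v" for s
    using that wt_pos[of v] by (auto simp: \<tau>_def divide_simps)
  let ?A = "{t \<in> {0..1}. EdgePt v (succ v) t \<in> U}"
  have "openin (top_of_set {0..1}) ?A" using U adj_succ[OF v] by (auto simp: open_in_complex_def)
  moreover have "\<tau> s \<in> ?A" using \<tau>[OF s] c curve_edge[OF v s] by (simp add: \<tau>_def)
  ultimately obtain e where e: "e > 0" "ball (\<tau> s) e \<inter> {0..1} \<subseteq> ?A"
    unfolding openin_contains_ball by blast
  show ?thesis
  proof (intro exI[of _ "e * wt v"] conjI allI impI)
    show "e * wt v > 0" using e wt_pos by simp
    fix s' assume s': "pos v \<le> s'" "s' \<le> pos v + wt v" "\<bar>s' - s\<bar> < e * wt v"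
    have "\<tau> s - \<tau> s' = (s - s') / wt v" by (simp add: \<tau>_def diff_divide_distrib)
    then have "\<bar>\<tau> s - \<tau> s'\<bar> = \<bar>s' - s\<bar> / wt v" using wt_pos[of v] by (simp add: abs_minus_commute)
    also have "\<dots> < e" using s'(3) wt_pos[of v] by (simp add: divide_simps)
    finally have "\<tau> s' \<in> ?A" using e(2) \<tau>[OF s'(1,2)] by (auto simp: dist_real_def)
    then show "curve s' \<in> U" using curve_edge[OF v s'(1,2)] by (simp add: \<tau>_def)
  qed
qed

text \<open>Sets of the complex contain no ends, so \<open>s\<close> is not a gap, and an edge is
  traversed on each available side of \<open>s\<close>. The two sides are treated separately since
  \<open>s\<close> may be a vertex.\<close>

lemma curve_open_complex:
  assumes U: "open_in_complex G U" and s: "0 \<le> s" "s \<le> total_wt" and c: "curve s \<in> U"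
  shows "\<exists>e>0. \<forall>s'. 0 \<le> s' \<longrightarrow> s' \<le> total_wt \<longrightarrow> \<bar>s' - s\<bar> < e \<longrightarrow> curve s' \<in> U"
proof -
  have "U \<subseteq> one_complex G" using U by (simp add: open_in_complex_def)
  then have ng: "\<not> gap s" using c curve_gap by (auto simp: one_complex_def)
  have "\<exists>e>0. \<forall>s'. 0 \<le> s' \<longrightarrow> s' \<le> s \<longrightarrow> \<bar>s' - s\<bar> < e \<longrightarrow> curve s' \<in> U"
  proof (cases "s = 0")
    case True then show ?thesis using c by (intro exI[of _ 1]) auto
  next
    case False
    \<comment> \<open>The edge arriving at \<open>s\<close> from the left: the predecessor's edge if
      \<open>s\<close> is the position of a vertex.\<close>
    have "\<exists>u\<in>V. pos u < s \<and> s \<le> pos u + wt u"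
    proof (cases "s = total_wt")
      case True then show ?thesis using pos_m wt_pos[of m] m by (intro bexI[of _ m]) auto
    next
      case False
      then obtain v where v: "v \<in> V" "pos v \<le> s" "s < pos v + wt v" using ng s gap_cases[of s] by force
      show ?thesis
      proof (cases "pos v = s")
        case True
        then have "v \<noteq> v0" using \<open>s \<noteq> 0\<close> by auto
        then obtain u where u: "u \<in> V" "u \<noteq> m" "succ u = v" using ex_pred v(1) by blast
        then show ?thesis using pos_succ[of u] wt_pos[of u] True by (intro bexI[of _ u]) auto
      next
        case False then show ?thesis using v by (intro bexI[of _ v]) auto
      qed
    qed
    then obtain u where u: "u \<in> V" "pos u < s" "s \<le> pos u + wt u" by blast
    obtain e where e: "e > 0" "\<And>s'. pos u \<le> s' \<Longrightarrow> s' \<le> pos u + wt u \<Longrightarrow> \<bar>s' - s\<bar> < e \<Longrightarrow> curve s' \<in> U"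
      using curve_open_edge[OF U u(1) _ u(3) c] u(2) by auto
    show ?thesis using e u by (intro exI[of _ "min e (s - pos u)"]) auto
  qed
  then obtain e1 where e1: "e1 > 0" "\<And>s'. 0 \<le> s' \<Longrightarrow> s' \<le> s \<Longrightarrow> \<bar>s' - s\<bar> < e1 \<Longrightarrow> curve s' \<in> U" by blast
  have "\<exists>e>0. \<forall>s'. s \<le> s' \<longrightarrow> s' \<le> total_wt \<longrightarrow> \<bar>s' - s\<bar> < e \<longrightarrow> curve s' \<in> U"
  proof (cases "s = total_wt")
    case True then show ?thesis using c by (intro exI[of _ 1]) auto
  next
    case False
    then obtain v where v: "v \<in> V" "pos v \<le> s" "s < pos v + wt v" using ng s gap_cases[of s] by force
    obtain e where e: "e > 0" "\<And>s'. pos v \<le> s' \<Longrightarrow> s' \<le> pos v + wt v \<Longrightarrow> \<bar>s' - s\<bar> < e \<Longrightarrow> curve s' \<in> U"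
      using curve_open_edge[OF U v(1,2) _ c] v(3) by auto
    show ?thesis using e v by (intro exI[of _ "min e (pos v + wt v - s)"]) auto
  qed
  then obtain e2 where e2: "e2 > 0" "\<And>s'. s \<le> s' \<Longrightarrow> s' \<le> total_wt \<Longrightarrow> \<bar>s' - s\<bar> < e2 \<Longrightarrow> curve s' \<in> U" by blast
  show ?thesis
  proof (intro exI[of _ "min e1 e2"] conjI allI impI)
    fix s' assume s': "0 \<le> s'" "s' \<le> total_wt" "\<bar>s' - s\<bar> < min e1 e2"
    then show "curve s' \<in> U" using e1(2)[of s'] e2(2)[of s'] by (cases "s' \<le> s") auto
  qed (use e1 e2 in simp)
qed

text \<open>Around a gap, all vertices positioned from \<open>l\<close> to \<open>r\<close> belong
  to \<open>C\<close>, hence so do the edges traversed between them, and other gaps in this range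
  have ends living in \<open>C\<close>. Other parameters are covered by
  \<open>open_end_nbhd\<close>.\<close>

lemma curve_open_end_nbhd:
  assumes S: "finite S" "S \<subseteq> V" and \<omega>: "end_lives_in G S \<omega> C" and \<epsilon>: "0 < \<epsilon>"
    and s: "0 \<le> s" "s \<le> total_wt" and c: "curve s \<in> end_nbhd G S C \<epsilon>"
  shows "\<exists>e>0. \<forall>s'. 0 \<le> s' \<longrightarrow> s' \<le> total_wt \<longrightarrow> \<bar>s' - s\<bar> < e \<longrightarrow> curve s' \<in> end_nbhd G S C \<epsilon>"
proof (cases "gap s")
  case False
  have C: "C \<in> graph_components (delete_verts G S)" using \<omega> by (simp add: end_lives_in_def)
  have "curve s \<in> range Pt"
  proof (cases "s = total_wt")
    case True then show ?thesis by (simp add: curve_total)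
  next
    case False
    then obtain v where "v \<in> V" "pos v \<le> s" "s < pos v + wt v"
      using \<open>\<not> gap s\<close> s gap_cases[of s] by force
    then show ?thesis using curve_edge_lt by simp
  qed
  then show ?thesis
    using curve_open_complex[OF open_end_nbhd[OF C \<epsilon>] s] c by fastforce
next
  case True
  obtain l r C' where lr: "l \<in> V" "r \<in> V" "pos l < s" "s < pos r" "end_lives_in G S (gap_end_of s) C'"
    "\<And>v. v \<in> V \<Longrightarrow> pos l \<le> pos v \<Longrightarrow> pos v \<le> pos r \<Longrightarrow> v \<in> C'" using gap_end_of[OF True S] by blast
  have "end_lives_in G S (gap_end_of s) C"
    using c curve_gap[OF True] by (auto simp: end_nbhd_def one_complex_def)
  then have C': "C' = C" using end_component_unique[OF S(1) lr(5)] by blast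
  have C: "C \<in> graph_components (delete_verts G S)" using \<omega> by (simp add: end_lives_in_def)
  show ?thesis
  proof (intro exI[of _ "min (s - pos l) (pos r - s)"] conjI allI impI)
    show "min (s - pos l) (pos r - s) > 0" using lr by simp
    fix s' assume s': "0 \<le> s'" "s' \<le> total_wt" "\<bar>s' - s\<bar> < min (s - pos l) (pos r - s)"
    then have in_lr: "pos l < s'" "s' < pos r" by auto
    then have lt: "s' < total_wt" using pos_le_total[OF lr(2)] wt_pos[of r] by linarith
    show "curve s' \<in> end_nbhd G S C \<epsilon>"
    proof (cases rule: gap_cases[OF s'(1) lt])
      case 1
      obtain l' r' C'' where lr': "l' \<in> V" "r' \<in> V" "pos l' < s'" "s' < pos r'"
        "end_lives_in G S (gap_end_of s') C''"
        "\<And>v. v \<in> V \<Longrightarrow> pos l' \<le> pos v \<Longrightarrow> pos v \<le> pos r' \<Longrightarrow> v \<in> C''" using gap_end_of[OF 1 S] by blast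
      \<comment> \<open>The later of the two left end points lies in both intervals, so the two
        components share a vertex and coincide.\<close>
      have "l \<in> C \<and> l \<in> C'' \<or> l' \<in> C \<and> l' \<in> C''"
      proof (cases "pos l' \<le> pos l")
        case True
        then show ?thesis using lr(6)[of l] lr'(6)[of l] lr(1-4) lr'(1-4) in_lr C' by auto
      next
        case False
        then show ?thesis using lr(6)[of l'] lr'(6)[of l'] lr(1-4) lr'(1-4) in_lr C' by auto
      qed
      moreover have "C'' \<in> graph_components (delete_verts G S)" using lr'(5) by (simp add: end_lives_in_def)
      ultimately have "C'' = C" using component_unique C by blast
      then show ?thesis using curve_gap[OF 1] lr'(5) by (auto simp: end_nbhd_def)
    next
      case (2 v)
      have "\<not> pos v < pos l" using pos_le_imp[OF 2(1) lr(1)] 2(3) in_lr by linarith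
      then have lv: "pos l \<le> pos v" by simp
      have vr: "pos v < pos r" using 2 in_lr by linarith
      then have "v \<noteq> m" using pos_le_imp[OF m lr(2)] pos_le_total[OF lr(2)] pos_m wt_pos[of r] by auto
      then have "pos (succ v) = pos v + wt v" using pos_succ 2(1) by blast
      then have "pos l \<le> pos (succ v)" "pos (succ v) \<le> pos r"
        using lv wt_pos[of v] pos_le_imp[OF 2(1) lr(2) vr] by auto
      then have "v \<in> C" "succ v \<in> C" using lr(6) C' 2(1) succ_in lv vr by auto
      then have "{v, succ v} \<in> edges (induced_subgraph G C)"
        using adj_succ[OF 2(1)] by (simp add: induced_subgraph_def)
      moreover have "0 \<le> (s' - pos v) / wt v \<and> (s' - pos v) / wt v \<le> 1"
        using 2 wt_pos[of v] by (auto simp: divide_simps)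
      ultimately have "curve s' \<in> one_complex (induced_subgraph G C)"
        unfolding curve_edge_lt[OF 2] one_complex_def by fastforce
      then show ?thesis by (simp add: end_nbhd_def)
    qed
  qed
qed

lemma continuous_curve: "continuous_map (top_of_set {0..total_wt}) (freudenthal G) curve"
  unfolding freudenthal_def
proof (rule continuous_on_generated_topo)
  let ?E = "{end_nbhd G S C \<epsilon> |S C \<epsilon>. finite S \<and> S \<subseteq> verts G \<and> 0 < \<epsilon> \<and> (\<exists>\<omega>. end_lives_in G S \<omega> C)}"
  fix U assume U: "U \<in> {U. open_in_complex G U} \<union> ?E"
  have "\<exists>e>0. \<forall>s'. 0 \<le> s' \<longrightarrow> s' \<le> total_wt \<longrightarrow> \<bar>s' - s\<bar> < e \<longrightarrow> curve s' \<in> U"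
    if s: "0 \<le> s" "s \<le> total_wt" "curve s \<in> U" for s
    using U
  proof
    assume "U \<in> {U. open_in_complex G U}"
    then show ?thesis using curve_open_complex s by simp
  next
    assume "U \<in> ?E"
    then obtain S C \<epsilon> \<omega> where "U = end_nbhd G S C \<epsilon>" "finite S" "S \<subseteq> V" "0 < \<epsilon>" "end_lives_in G S \<omega> C"
      by blast
    then show ?thesis using curve_open_end_nbhd s by simp
  qed
  then show "openin (top_of_set {0..total_wt}) (curve -` U \<inter> topspace (top_of_set {0..total_wt}))"
    unfolding openin_contains_ball by (fastforce simp: dist_real_def abs_minus_commute subset_iff)
next
  let ?E = "{end_nbhd G S C \<epsilon> |S C \<epsilon>. finite S \<and> S \<subseteq> verts G \<and> 0 < \<epsilon> \<and> (\<exists>\<omega>. end_lives_in G S \<omega> C)}"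
  show "curve ` topspace (top_of_set {0..total_wt}) \<subseteq> \<Union> ({U. open_in_complex G U} \<union> ?E)"
  proof
    fix x assume "x \<in> curve ` topspace (top_of_set {0..total_wt})"
    then obtain s where s: "0 \<le> s" "s \<le> total_wt" "x = curve s" by auto
    show "x \<in> \<Union> ({U. open_in_complex G U} \<union> ?E)"
    proof (cases "gap s")
      case True
      obtain C where C: "end_lives_in G {} (gap_end_of s) C" using gap_end_of[OF True, of "{}"] by blast
      then have "x \<in> end_nbhd G {} C 1" using curve_gap[OF True] s(3) by (auto simp: end_nbhd_def)
      moreover have "end_nbhd G {} C 1 \<in> ?E" using C
        by (intro CollectI) (rule exI[of _ "{}"], rule exI[of _ C], rule exI[of _ 1], auto)
      ultimately show ?thesis by blast
    next
      case False
      have "x \<in> one_complex G"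
      proof (cases "s = total_wt")
        case True then show ?thesis using s v0 by (simp add: curve_total one_complex_def)
      next
        case False
        then obtain v where v: "v \<in> V" "pos v \<le> s" "s < pos v + wt v"
          using \<open>\<not> gap s\<close> s gap_cases[of s] by force
        then show ?thesis using s curve_edge_lt[OF v] wt_pos[of v]
          by (auto intro!: edge_point_in_complex simp: divide_simps)
      qed
      then show ?thesis using open_one_complex by blast
    qed
  qed
qed

section \<open>Closing the parameter interval to a circle\<close>

theorem exists_hamiltonian_curve: "\<exists>K. hamiltonian_curve G K"
proof -
  define h where "h t = exp (2 * of_real pi * \<i> * of_real (t / total_wt))" for t :: real
  define f where "f z = curve (total_wt * (Arg2pi z / (2 * pi)))" for z
  have h_cis: "h t = exp (\<i> * of_real (2 * pi * (t / total_wt)))" for t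
    by (simp add: h_def mult_ac)
  have arg: "Arg2pi (h t) = 2 * pi * (t / total_wt)" if "0 \<le> t" "t < total_wt" for t
  proof (rule Arg2pi_unique[of 1])
    have "t / total_wt < 1" using that total_pos by simp
    then show "2 * pi * (t / total_wt) < 2 * pi" using mult_strict_left_mono[of "t / total_wt" 1 "2 * pi"] by simp
  qed (use that total_pos in \<open>auto simp: h_cis\<close>)
  have fh: "f (h t) = curve t" if "0 \<le> t" "t \<le> total_wt" for t
  proof (cases "t = total_wt")
    case True
    have "h t = 1" using True total_pos by (simp add: h_def mult_ac)
    \<comment> \<open>The two ends of the interval are glued at 1, where the curve takes the value
      \<open>v0\<close> from either end.\<close>
    moreover have "curve 0 = Vertex v0" using curve_vertex_iff[of 0 v0] total_pos v0 by simp
    moreover have "Arg2pi 1 = 0" by (rule Arg2pi_unique[of 1]) auto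
    ultimately show ?thesis by (simp add: f_def True curve_total)
  next
    case False then show ?thesis using arg[of t] that total_pos by (simp add: f_def)
  qed
  have surj: "\<exists>t. 0 \<le> t \<and> t < total_wt \<and> z = h t" if "z \<in> sphere 0 1" for z
  proof (intro exI[of _ "total_wt * (Arg2pi z / (2 * pi))"] conjI)
    have "z = of_real (norm z) * exp (\<i> * of_real (Arg2pi z))" "norm z = 1"
      using Arg2pi[of z] that by (auto simp: is_Arg_def)
    then have "exp (\<i> * of_real (Arg2pi z)) = z" by (metis mult_1 of_real_1)
    then show "z = h (total_wt * (Arg2pi z / (2 * pi)))"
      using total_pos by (simp add: h_cis)
    have "Arg2pi z / (2 * pi) < 1" using Arg2pi_lt_2pi[of z] by simp
    then show "total_wt * (Arg2pi z / (2 * pi)) < total_wt" using total_pos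
      by (metis mult.right_neutral mult_less_cancel_left_pos)
  qed (use Arg2pi_ge_0[of z] total_pos in auto)
  have hs: "h t \<in> sphere 0 1" for t by (simp add: h_cis)
  \<comment> \<open>A continuous surjection from a compact to a Hausdorff space is a quotient map,
    so continuity of \<open>f\<close> can be checked on the interval although \<open>Arg2pi\<close>
    jumps at 1.\<close>
  have "quotient_map (top_of_set {0..total_wt}) (top_of_set (sphere 0 1)) h"
  proof (rule continuous_imp_quotient_map)
    have "continuous_on {0..total_wt} h" unfolding h_def using total_pos by (intro continuous_intros) auto
    then show "continuous_map (top_of_set {0..total_wt}) (top_of_set (sphere 0 1)) h"
      using hs by auto
    show "compact_space (top_of_set {0..total_wt})" by (simp add: compact_space_subtopology)
    show "Hausdorff_space (top_of_set (sphere (0::complex) 1))"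
      by (simp add: Hausdorff_space_subtopology)
    show "h ` topspace (top_of_set {0..total_wt}) = topspace (top_of_set (sphere 0 1))"
      using hs surj by (force simp: image_iff)
  qed
  moreover have "continuous_map (top_of_set {0..total_wt}) (freudenthal G) (f \<circ> h)"
    by (rule continuous_map_eq[OF continuous_curve]) (simp add: fh)
  ultimately have cont: "continuous_map (top_of_set (sphere 0 1)) (freudenthal G) f"
    using continuous_compose_quotient_map_eq by blast
  have once: "\<exists>!z. z \<in> sphere 0 1 \<and> f z = Vertex v" if v: "v \<in> V" for v
  proof (rule ex1I[of _ "h (pos v)"])
    have p: "0 \<le> pos v" "pos v < total_wt" using pos_nonneg[of v] pos_le_total[OF v] wt_pos[of v] by auto
    then show "h (pos v) \<in> sphere 0 1 \<and> f (h (pos v)) = Vertex v"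
      using hs fh[of "pos v"] curve_vertex_iff[OF p v] by simp
    fix z assume z: "z \<in> sphere 0 1 \<and> f z = Vertex v"
    then obtain t where t: "0 \<le> t" "t < total_wt" "z = h t" using surj by blast
    then show "z = h (pos v)" using z fh[of t] curve_vertex_iff[OF t(1,2) v] by simp
  qed
  have "hamiltonian_curve G (f ` sphere 0 1)"
    unfolding hamiltonian_curve_def by (intro exI[of _ f] conjI ballI cont refl once)
  then show ?thesis by blast
qed

end

theorem (in cycle_cofinal_graph) exists_hamiltonian_curve: "\<exists>K. hamiltonian_curve G K"
proof -
  obtain lt v0 m where "limit_order_graph G lt v0 m" by (rule exists_limit_order)
  then interpret limit_order_graph G lt v0 m .
  show ?thesis by (rule exists_hamiltonian_curve)
qed

theorem theorem5p4:
  fixes G :: "'a ugraph"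
  assumes "simple_graph G"
    and "connected_graph G"
    and "infinite (verts G)"
    and "locally_finite G"
    and "\<And>x. x \<in> verts G \<Longrightarrow> k_connected 2 (graph_ball G 2 x)"
    and "\<And>u w v. graph_path G [u, w, v] \<Longrightarrow> {u, v} \<notin> edges G \<Longrightarrow>
           int (graph_degree G u) + int (graph_degree G v) \<ge> int (card (ball_verts G 2 w)) - 1"
  shows "\<exists>K. hamiltonian_curve G K"
proof -
  interpret ore_graph G using assms by unfold_locales
  interpret cycle_cofinal_graph G
    using finite_subset_cycle by unfold_locales
  show ?thesis by (rule exists_hamiltonian_curve)
qed

end
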